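(* For integers $m\ge1$ and $0\le\ell\le m-1$, let $\gamma_{m,\ell}$ be the Hölder regularity of the (primal) pseudo-spline subdivision scheme with symbol $$a_{m,\ell}(z)=2\sigma^m(z)\sum_{k=0}^{\ell}\binom{m-1+k}{k}\delta^k(z),$$ and let $\tilde\gamma_{m,\ell}$ be the Hölder regularity of the dual pseudo-spline subdivision scheme with symbol $$\tilde a_{m,\ell}(z)=\frac{1+z}{z}\,\sigma^m(z)\sum_{k=0}^{\ell}\binom{m-1/2+k}{k}\delta^k(z),$$ where $\sigma(z)=\frac{(1+z)^2}{4z}$ and $\delta(z)=-\frac{(1-z)^2}{4z}$. Then for $m\ge1$ and $0\le\ell\le m-1$, $$\gamma_{m,\ell}+\log_2\left(2\prod_{n=0}^{\ell-1}\frac{m+n}{m+1/2+n}\right)\le\tilde\gamma_{m,\ell}\le\gamma_{m,\ell}+1,$$ $$\tilde\gamma_{m,\ell}+\log_2\left(2\prod_{n=0}^{\ell-1}\frac{m+1/2+n}{m+1+n}\right)\le\gamma_{m+1,\ell}\le\tilde\gamma_{m,\ell}+1,$$ where an empty product is understood to mean $1$.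
   Context: Generalized binomials: $\binom{x+k}{k}=\prod_{i=1}^k\frac{x+i}{i}$ for real $x$ and integer $k\ge0$. A subdivision scheme with symbol $a(z)=\sum_k a_kz^k$ (a Laurent polynomial with real coefficients) acts on real initial data $(f_{0,k})_{k\in\mathbb{Z}}$, only finitely many of which are non-zero, by $f_{j+1,k}=\sum_\ell a_{k-2\ell}f_{j,\ell}$. Let $f_j$ be the piecewise linear function with value $f_{j,k}$ at $2^{-j}k$; the limit function is the pointwise limit $f=\lim_{j\to\infty}f_j$. Hölder classes: for $0<\alpha<1$, $f\in C^\alpha$ means $|f(x)-f(y)|\le C|x-y|^\alpha$ for all $x,y\in\mathbb{R}$ and some constant $C$. For $q\in\mathbb{N}_0$, $f\in C^q$ means $f$ is $q$ times continuously differentiable, and $f\in C^{q+\alpha}$ means $f\in C^q$ and $f^{(q)}\in C^\alpha$. The scheme has Hölder regularity $\gamma\ge0$ if for $\beta<\gamma$, $f\in C^\beta$ for all initial data, and for $\beta>\gamma$, $f\notin C^\beta$ for some initial data. *)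

theory Defs
  imports "HOL-Analysis.Analysis" "HOL-Computational_Algebra.Formal_Laurent_Series"
begin

(* Symbols are Laurent polynomials, taken as elements of the field of formal Laurent series;
   the coefficient a_k of the symbol a is fls_nth a k. *)

definition subdivide :: "real fls \<Rightarrow> (int \<Rightarrow> real) \<Rightarrow> int \<Rightarrow> real" where
  "subdivide a g k = (\<Sum>l | fls_nth a (k - 2 * l) \<noteq> 0. fls_nth a (k - 2 * l) * g l)"

text \<open>For a Laurent polynomial the index set above is finite, so this is the full sum over
  all integers; the data need not be finitely supported for that.\<close>

lemma finite_subdivide_index:
  assumes "finite {k. fls_nth a k \<noteq> 0}"
  shows "finite {l. fls_nth a (k - 2 * l) \<noteq> 0}"
proof -
  have "{l. fls_nth a (k - 2 * l) \<noteq> 0} = (\<lambda>l. k - 2 * l) -` {k. fls_nth a k \<noteq> 0}"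
    by auto
  moreover have "inj (\<lambda>l. k - 2 * l)"
    by (auto simp: inj_on_def)
  ultimately show ?thesis
    using assms finite_vimageI by metis
qed

definition finite_data :: "(int \<Rightarrow> real) \<Rightarrow> bool" where
  "finite_data g \<longleftrightarrow> finite {k. g k \<noteq> 0}"

definition linear_interp :: "nat \<Rightarrow> (int \<Rightarrow> real) \<Rightarrow> real \<Rightarrow> real" where
  "linear_interp j g x =
     (1 - frac (2 ^ j * x)) * g \<lfloor>2 ^ j * x\<rfloor> + frac (2 ^ j * x) * g (\<lfloor>2 ^ j * x\<rfloor> + 1)"

lemma linear_interp_grid: "linear_interp j g (real_of_int k / 2 ^ j) = g k"
  by (simp add: linear_interp_def)

definition scheme_fun :: "real fls \<Rightarrow> (int \<Rightarrow> real) \<Rightarrow> nat \<Rightarrow> real \<Rightarrow> real" where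
  "scheme_fun a g j = linear_interp j ((subdivide a ^^ j) g)"

definition limit_fun :: "real fls \<Rightarrow> (int \<Rightarrow> real) \<Rightarrow> real \<Rightarrow> real" where
  "limit_fun a g x = lim (\<lambda>j. scheme_fun a g j x)"

definition C_nat :: "nat \<Rightarrow> (real \<Rightarrow> real) \<Rightarrow> bool" where
  "C_nat q f \<longleftrightarrow>
     (\<forall>i<q. (deriv ^^ i) f differentiable_on UNIV) \<and> continuous_on UNIV ((deriv ^^ q) f)"

definition C_frac :: "real \<Rightarrow> (real \<Rightarrow> real) \<Rightarrow> bool" where
  "C_frac \<alpha> f \<longleftrightarrow> (\<exists>C. \<forall>x y. \<bar>f x - f y\<bar> \<le> C * \<bar>x - y\<bar> powr \<alpha>)"

text \<open>The class of order \<open>\<beta> \<ge> 0\<close>, with \<open>q\<close> and \<open>\<alpha>\<close> the integer and fractional parts of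
  \<open>\<beta>\<close>. For integer \<open>\<beta>\<close> it is plain continuous differentiability, not a Lipschitz class.\<close>

definition C_holder :: "real \<Rightarrow> (real \<Rightarrow> real) \<Rightarrow> bool" where
  "C_holder \<beta> f \<longleftrightarrow>
     C_nat (nat \<lfloor>\<beta>\<rfloor>) f \<and> (frac \<beta> > 0 \<longrightarrow> C_frac (frac \<beta>) ((deriv ^^ nat \<lfloor>\<beta>\<rfloor>) f))"

text \<open>The first conjunct after \<open>\<gamma> \<ge> 0\<close> makes the limit function meaningful, as \<open>lim\<close> is
  arbitrary for a divergent sequence.\<close>

definition has_holder_regularity :: "real fls \<Rightarrow> real \<Rightarrow> bool" where
  "has_holder_regularity a \<gamma> \<longleftrightarrow>
     \<gamma> \<ge> 0 \<and>
     (\<forall>g. finite_data g \<longrightarrow> (\<forall>x. convergent (\<lambda>j. scheme_fun a g j x))) \<and>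
     (\<forall>\<beta>. 0 \<le> \<beta> \<and> \<beta> < \<gamma> \<longrightarrow> (\<forall>g. finite_data g \<longrightarrow> C_holder \<beta> (limit_fun a g))) \<and>
     (\<forall>\<beta>>\<gamma>. \<exists>g. finite_data g \<and> \<not> C_holder \<beta> (limit_fun a g))"

lemma has_holder_regularity_unique:
  assumes "has_holder_regularity a \<gamma>" "has_holder_regularity a \<gamma>'"
  shows "\<gamma> = \<gamma>'"
proof -
  have "\<not> x < y" if x: "has_holder_regularity a x" and y: "has_holder_regularity a y" for x y
  proof
    assume "x < y"
    then obtain \<beta> where "x < \<beta>" "\<beta> < y"
      using dense by blast
    with x y show False
      unfolding has_holder_regularity_def by (meson less_imp_le order_trans)
  qed
  with assms show ?thesis
    by (meson linorder_neqE)
qed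

definition holder_regularity :: "real fls \<Rightarrow> real" where
  "holder_regularity a = (THE \<gamma>. has_holder_regularity a \<gamma>)"

lemma holder_regularity_eq: "has_holder_regularity a \<gamma> \<Longrightarrow> holder_regularity a = \<gamma>"
  unfolding holder_regularity_def
  by (rule the_equality) (auto intro: has_holder_regularity_unique)

definition symb_sigma :: "real fls" where
  "symb_sigma = (1 + fls_X)^2 / (4 * fls_X)"

definition symb_delta :: "real fls" where
  "symb_delta = - ((1 - fls_X)^2 / (4 * fls_X))"

lemma fls_finite_support_mult:
  fixes a b :: "real fls"
  assumes "finite {k. fls_nth a k \<noteq> 0}" "finite {k. fls_nth b k \<noteq> 0}"
  shows "finite {k. fls_nth (a * b) k \<noteq> 0}"
proof (rule finite_subset)
  show "{k. fls_nth (a * b) k \<noteq> 0} \<subseteq>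
      (\<lambda>(i, j). i + j) ` ({k. fls_nth a k \<noteq> 0} \<times> {k. fls_nth b k \<noteq> 0})"
  proof
    fix n assume "n \<in> {k. fls_nth (a * b) k \<noteq> 0}"
    then obtain i where "fls_nth a i * fls_nth b (n - i) \<noteq> 0"
      by (force simp: fls_times_nth(2) elim: sum.not_neutral_contains_not_neutral)
    then show "n \<in> (\<lambda>(i, j). i + j) ` ({k. fls_nth a k \<noteq> 0} \<times> {k. fls_nth b k \<noteq> 0})"
      by (auto intro!: image_eqI[of _ _ "(i, n - i)"])
  qed
qed (use assms in auto)

lemma fls_finite_support_power:
  fixes a :: "real fls"
  assumes "finite {k. fls_nth a k \<noteq> 0}"
  shows "finite {k. fls_nth (a ^ n) k \<noteq> 0}"
proof (induction n)
  case (Suc n)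
  then show ?case
    using fls_finite_support_mult[OF assms Suc] by simp
qed simp

lemma fls_finite_support_sum:
  fixes f :: "nat \<Rightarrow> real fls"
  assumes "finite A" "\<And>i. finite {k. fls_nth (f i) k \<noteq> 0}"
  shows "finite {k. fls_nth (\<Sum>i\<in>A. f i) k \<noteq> 0}"
  using assms(1)
proof (induction A rule: finite_induct)
  case (insert i A)
  have "{k. fls_nth (\<Sum>i\<in>insert i A. f i) k \<noteq> 0} \<subseteq>
      {k. fls_nth (f i) k \<noteq> 0} \<union> {k. fls_nth (\<Sum>i\<in>A. f i) k \<noteq> 0}"
    using insert by auto
  then show ?case
    using insert.IH assms(2) by (meson finite_Un finite_subset)
qed simp

lemma symb_sigma_Laurent:
  "symb_sigma = fls_const (1/4) * fls_X_inv + fls_const (1/2) + fls_const (1/4) * fls_X"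
proof -
  have "fls_X_inv * fls_X = (1 :: real fls)"
    unfolding fls_inverse_X[symmetric] by (rule left_inverse) simp
  moreover have "fls_const (1/4) * 4 = (1 :: real fls)" "fls_const (1/2) * 4 = (2 :: real fls)"
    unfolding fls_const_numeral[symmetric] fls_const_mult_const by simp_all
  ultimately have
    "(fls_const (1/4) * fls_X_inv + fls_const (1/2) + fls_const (1/4) * fls_X) * (4 * fls_X)
       = (1 + fls_X :: real fls)^2"
    by algebra
  then show ?thesis
    by (simp add: symb_sigma_def nonzero_divide_eq_eq)
qed

lemma symb_delta_Laurent:
  "symb_delta = fls_const (1/2) - fls_const (1/4) * fls_X_inv - fls_const (1/4) * fls_X"
proof -
  have "fls_X_inv * fls_X = (1 :: real fls)"
    unfolding fls_inverse_X[symmetric] by (rule left_inverse) simp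
  moreover have "fls_const (1/4) * 4 = (1 :: real fls)" "fls_const (1/2) * 4 = (2 :: real fls)"
    unfolding fls_const_numeral[symmetric] fls_const_mult_const by simp_all
  ultimately have
    "(fls_const (1/2) - fls_const (1/4) * fls_X_inv - fls_const (1/4) * fls_X) * (4 * fls_X)
       = - ((1 - fls_X :: real fls)^2)"
    by algebra
  then show ?thesis
    unfolding symb_delta_def minus_divide_left by (subst nonzero_divide_eq_eq) auto
qed

lemma finite_support_sigma_delta:
  "finite {k. fls_nth symb_sigma k \<noteq> 0}" "finite {k. fls_nth symb_delta k \<noteq> 0}"
proof -
  have "{k. fls_nth symb_sigma k \<noteq> 0} \<subseteq> {-1, 0, 1}" "{k. fls_nth symb_delta k \<noteq> 0} \<subseteq> {-1, 0, 1}"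
    by (auto simp: symb_sigma_Laurent symb_delta_Laurent split: if_splits)
  then show "finite {k. fls_nth symb_sigma k \<noteq> 0}" "finite {k. fls_nth symb_delta k \<noteq> 0}"
    by (auto intro: finite_subset)
qed

lemma gchoose_eq_prod: "(x + real k) gchoose k = (\<Prod>i=1..k. (x + real i) / real i)"
proof (induction k)
  case (Suc k)
  have "(x + real (Suc k)) gchoose Suc k = ((x + real k) + 1) gchoose Suc k"
    by (simp add: add_ac)
  also have "\<dots> = (x + real k + 1) / real (Suc k) * ((x + real k) gchoose k)"
    by (rule gbinomial_factors)
  finally show ?case
    using Suc by (simp add: add_ac mult_ac)
qed simp

definition primal_symbol :: "nat \<Rightarrow> nat \<Rightarrow> real fls" where
  "primal_symbol m l =
     2 * symb_sigma ^ m * (\<Sum>k\<le>l. fls_const ((real m - 1 + real k) gchoose k) * symb_delta ^ k)"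

definition dual_symbol :: "nat \<Rightarrow> nat \<Rightarrow> real fls" where
  "dual_symbol m l =
     (1 + fls_X) / fls_X * symb_sigma ^ m *
       (\<Sum>k\<le>l. fls_const ((real m - 1/2 + real k) gchoose k) * symb_delta ^ k)"

lemma fls_finite_support_const: "finite {k. fls_nth (fls_const (c::real)) k \<noteq> 0}"
  by (rule finite_subset[of _ "{0}"]) auto

lemma finite_support_primal: "finite {k. fls_nth (primal_symbol m l) k \<noteq> 0}"
proof -
  have "finite {k. fls_nth (2 :: real fls) k \<noteq> 0}"
    using fls_finite_support_const[of 2] by simp
  then show ?thesis
    unfolding primal_symbol_def
    by (intro fls_finite_support_mult fls_finite_support_power fls_finite_support_sum
        fls_finite_support_const finite_support_sigma_delta) auto
qed

lemma finite_support_dual: "finite {k. fls_nth (dual_symbol m l) k \<noteq> 0}"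
proof -
  have "(1 + fls_X) / fls_X = (fls_X_inv + 1 :: real fls)"
    unfolding fls_inverse_X[symmetric] divide_inverse
    by (subst distrib_right, subst right_inverse) simp_all
  moreover have "finite {k. fls_nth (fls_X_inv + 1 :: real fls) k \<noteq> 0}"
    by (rule finite_subset[of _ "{-1, 0}"]) (auto split: if_splits)
  ultimately show ?thesis
    unfolding dual_symbol_def
    by (intro fls_finite_support_mult fls_finite_support_power fls_finite_support_sum
        fls_finite_support_const finite_support_sigma_delta) auto
qed

end

theory Submission
  imports Defs
begin

text \<open>
  Write a symbol as \<open>2 ((1 + z) / 2)\<^sup>N c(z)\<close>, where on the unit circle \<open>c\<close> is a monomial times a real
  function \<open>\<beta> \<ge> 1\<close>. Up to a monomial, \<open>c\<^sub>n(z) = c(z) c(z\<^sup>2) c(z\<^sup>4) \<dots>\<close> (\<open>n\<close> factors) is then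
  nonnegative on the circle, so its largest coefficient is the central one, which is its mean
  value. The \<open>N\<close>-th differences of the data of level \<open>n\<close> have generating function
  \<open>(2 / 2\<^sup>N)\<^sup>n c\<^sub>n(z)\<close> times a fixed factor in \<open>z\<close> to the power \<open>2\<^sup>n\<close>; hence the Hoelder regularity is
  \<open>N - 1 - log\<^sub>2 \<rho>\<close>, where \<open>\<rho>\<close> is the exponential growth rate of these mean values. The
  regularity is attained as a lower bound by the usual contraction of differences, and it cannot
  be exceeded because a weighted average of \<open>N\<close>-th differences of the limit function, with
  weights chosen to keep the Fourier side nonnegative, recovers the mean value up to a constant
  factor.

  For pseudo-splines \<open>\<beta>\<close> is a polynomial with nonnegative coefficients in \<open>sin\<^sup>2(t/2) \<in> [0, 1]\<close>. The
  coefficients \<open>(x + k) gchoose k\<close> increase with \<open>x\<close>, and replacing \<open>x\<close> by \<open>x + 1/2\<close> multiplies them by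
  at most \<open>\<Prod>n<l. (x + 3/2 + n) / (x + 1 + n)\<close>; the growth rates compare accordingly.
\<close>

unbundle fps_syntax

subsection \<open>Laurent polynomials on the unit circle\<close>

text \<open>Hoelder regularity is defined by strict inequalities on both sides, so only exponential
  rates matter and fixed factors such as \<open>2 * pi\<close> or \<open>16 ^ N\<close> are given
  away freely.

  The obstacle in the upper bound is that smoothness is known for the limit function, whereas the
  mean values belong to refined data, which are not samples of the limit. The step
  \<open>1 / 2 ^ n\<close> of the differences is therefore kept while the data are refined to level
  \<open>n + p\<close> and \<open>p\<close> tends to infinity; the weights must be such that all
  powers of \<open>2 ^ p\<close> cancel.

  The half step in \<open>x\<close> is matched by one further factor \<open>1 + z\<close>: the
  primal symbol for \<open>m\<close>, the dual symbol for \<open>m\<close> and the primal symbol for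
  \<open>m + 1\<close> have \<open>N = 2 * m, 2 * m + 1, 2 * m + 2\<close> and
  \<open>x = m - 1, m - 1/2, m\<close>. The four inequalities are thus two comparisons of growth
  rates, each used at \<open>x = m - 1\<close> and \<open>x = m - 1/2\<close>; the increase of
  \<open>N\<close> by one supplies the 1 on the right and the 2 inside the logarithm. The condition
  \<open>l \<le> m - 1\<close> is what makes the regularity provably positive, through a bound of
  \<beta> by a binomial coefficient below \<open>2 ^ N / 2\<close>.\<close>

definition fls_supp :: "real fls \<Rightarrow> int set" where
  "fls_supp p = {k. p $$ k \<noteq> 0}"

lemma fls_nth_notin_supp: "k \<notin> fls_supp p \<Longrightarrow> p $$ k = 0"
  by (simp add: fls_supp_def)

lemma finite_fls_supp_mult: "finite (fls_supp p) \<Longrightarrow> finite (fls_supp q) \<Longrightarrow> finite (fls_supp (p * q))"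
  unfolding fls_supp_def by (rule fls_finite_support_mult)

lemma finite_fls_supp_power: "finite (fls_supp p) \<Longrightarrow> finite (fls_supp (p ^ n))"
  unfolding fls_supp_def by (rule fls_finite_support_power)

lemma finite_fls_supp_const [simp]: "finite (fls_supp (fls_const c))"
  unfolding fls_supp_def by (rule fls_finite_support_const)

lemma finite_fls_supp_0 [simp]: "finite (fls_supp 0)"
  by (simp add: fls_supp_def)

lemma finite_fls_supp_1 [simp]: "finite (fls_supp 1)"
  using finite_fls_supp_const[of 1] by simp

lemma finite_fls_supp_add: "finite (fls_supp p) \<Longrightarrow> finite (fls_supp q) \<Longrightarrow> finite (fls_supp (p + q))"
  by (rule finite_subset[of _ "fls_supp p \<union> fls_supp q"]) (auto simp: fls_supp_def)

lemma finite_fls_supp_diff: "finite (fls_supp p) \<Longrightarrow> finite (fls_supp q) \<Longrightarrow> finite (fls_supp (p - q))"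
  by (rule finite_subset[of _ "fls_supp p \<union> fls_supp q"]) (auto simp: fls_supp_def)

lemma finite_fls_supp_X [simp]: "finite (fls_supp fls_X)"
  by (rule finite_subset[of _ "{1}"]) (auto simp: fls_supp_def split: if_splits)

lemma finite_fls_supp_X_intpow [simp]: "finite (fls_supp (fls_X_intpow s))"
  by (rule finite_subset[of _ "{s}"]) (auto simp: fls_supp_def split: if_splits)

lemma finite_fls_supp_compose_power:
  assumes "finite (fls_supp p)" "d > 0"
  shows "finite (fls_supp (fls_compose_power p d))"
proof (rule finite_subset)
  show "fls_supp (fls_compose_power p d) \<subseteq> (\<lambda>k. int d * k) ` fls_supp p"
    using assms(2) by (auto simp: fls_supp_def fls_nth_compose_power split: if_splits)
qed (use assms in auto)

lemmas finite_fls_supp_intros = finite_fls_supp_mult finite_fls_supp_power finite_fls_supp_add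
  finite_fls_supp_diff finite_fls_supp_compose_power finite_fls_supp_const finite_fls_supp_1
  finite_fls_supp_X finite_fls_supp_X_intpow

lemma fls_times_nth_supp:
  fixes p q :: "real fls"
  assumes "finite S" "fls_supp p \<subseteq> S"
  shows "(p * q) $$ n = (\<Sum>i\<in>S. p $$ i * q $$ (n - i))"
proof -
  define I where "I = {fls_subdegree p..n - fls_subdegree q}"
  have z: "p $$ i * q $$ (n - i) = 0" if "i \<notin> I" for i
    using that unfolding I_def by (auto simp: not_le)
  have "(p * q) $$ n = (\<Sum>i\<in>I. p $$ i * q $$ (n - i))"
    unfolding I_def by (rule fls_times_nth)
  also have "\<dots> = (\<Sum>i\<in>I \<inter> S. p $$ i * q $$ (n - i))"
    by (rule sum.mono_neutral_right) (use assms in \<open>auto simp: I_def fls_supp_def\<close>)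
  also have "\<dots> = (\<Sum>i\<in>S. p $$ i * q $$ (n - i))"
    by (rule sum.mono_neutral_left) (use assms z in \<open>auto\<close>)
  finally show ?thesis .
qed

lemma abs_fls_times_nth_le:
  assumes "finite (fls_supp p)" "\<And>i. i \<in> fls_supp p \<Longrightarrow> \<bar>q $$ (n - i)\<bar> \<le> E"
  shows "\<bar>(p * q) $$ n\<bar> \<le> (\<Sum>i\<in>fls_supp p. \<bar>p $$ i\<bar>) * E"
proof -
  have "\<bar>(p * q) $$ n\<bar> \<le> (\<Sum>i\<in>fls_supp p. \<bar>p $$ i * q $$ (n - i)\<bar>)"
    unfolding fls_times_nth_supp[OF assms(1) subset_refl] by (rule sum_abs)
  also have "\<dots> \<le> (\<Sum>i\<in>fls_supp p. \<bar>p $$ i\<bar> * E)"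
    by (intro sum_mono) (simp add: abs_mult mult_left_mono assms)
  finally show ?thesis
    by (simp add: sum_distrib_right)
qed

lemma fls_supp_mult_interval:
  assumes "fls_supp p \<subseteq> {a..b}" "fls_supp q \<subseteq> {c..d}"
  shows "fls_supp (p * q) \<subseteq> {a + c..b + d}"
proof
  fix n assume "n \<in> fls_supp (p * q)"
  then obtain i where "p $$ i * q $$ (n - i) \<noteq> 0"
    unfolding fls_supp_def fls_times_nth_supp[OF finite_atLeastAtMost_int assms(1)]
    by (auto elim: sum.not_neutral_contains_not_neutral)
  then have "i \<in> {a..b}" "n - i \<in> {c..d}"
    using assms by (auto simp: fls_supp_def)
  then show "n \<in> {a + c..b + d}" by auto
qed

lemma fls_supp_compose_power_interval:
  assumes "fls_supp p \<subseteq> {a..b}" "d > 0"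
  shows "fls_supp (fls_compose_power p d) \<subseteq> {int d * a..int d * b}"
proof
  fix n assume "n \<in> fls_supp (fls_compose_power p d)"
  then obtain k where "n = int d * k" "k \<in> fls_supp p"
    using assms(2) by (auto simp: fls_supp_def fls_nth_compose_power split: if_splits)
  then show "n \<in> {int d * a..int d * b}"
    using assms(1) by (auto intro!: mult_left_mono)
qed

lemma fls_supp_power_interval:
  assumes "fls_supp p \<subseteq> {0..b}"
  shows "fls_supp (p ^ n) \<subseteq> {0..int n * b}"
proof (induction n)
  case 0
  show ?case by (auto simp: fls_supp_def split: if_splits)
next
  case (Suc n)
  show ?case
    using fls_supp_mult_interval[OF assms Suc] by (simp add: algebra_simps)
qed

lemma fls_compose_power_compose_power:
  "d > 0 \<Longrightarrow> e > 0 \<Longrightarrow> fls_compose_power (fls_compose_power p d) e = fls_compose_power p (d * e)"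
  for p :: "real fls"
proof (rule fls_eqI)
  fix n assume "d > 0" "e > 0"
  then show "fls_compose_power (fls_compose_power p d) e $$ n = fls_compose_power p (d * e) $$ n"
    by (cases "int e dvd n") (auto simp: fls_nth_compose_power elim!: dvdE)
qed

lemma fls_compose_power_1_right [simp]: "fls_compose_power p (Suc 0) = p"
  by (rule fls_eqI) (simp add: fls_nth_compose_power)

text \<open>Evaluation at \<open>z = cis t\<close>. For infinite support the sum defaults to 0,
  whence the finiteness assumptions in the algebraic laws that follow.\<close>

definition trig :: "real fls \<Rightarrow> real \<Rightarrow> complex" where
  "trig p t = (\<Sum>k\<in>fls_supp p. of_real (p $$ k) * cis (of_int k * t))"

lemma trig_eq_sum:
  assumes "finite S" "fls_supp p \<subseteq> S"
  shows "trig p t = (\<Sum>k\<in>S. of_real (p $$ k) * cis (of_int k * t))"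
  unfolding trig_def by (rule sum.mono_neutral_left) (use assms in \<open>auto simp: fls_supp_def\<close>)

lemma trig_add:
  assumes "finite (fls_supp p)" "finite (fls_supp q)"
  shows "trig (p + q) t = trig p t + trig q t"
proof -
  let ?S = "fls_supp p \<union> fls_supp q"
  have "fls_supp (p + q) \<subseteq> ?S"
    by (auto simp: fls_supp_def)
  then show ?thesis
    using assms by (simp add: trig_eq_sum[of ?S] sum.distrib ring_distribs)
qed

lemma trig_sum:
  assumes "finite A" "\<And>i. i \<in> A \<Longrightarrow> finite (fls_supp (p i))"
  shows "trig (\<Sum>i\<in>A. p i) t = (\<Sum>i\<in>A. trig (p i) t) \<and> finite (fls_supp (\<Sum>i\<in>A. p i))"
  using assms
proof (induction A rule: finite_induct)
  case empty
  show ?case by (simp add: trig_def)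
next
  case (insert i A)
  then show ?case by (simp add: trig_add finite_fls_supp_add)
qed

lemma trig_const [simp]: "trig (fls_const c) t = of_real c"
proof -
  have "fls_supp (fls_const c) \<subseteq> {0}"
    by (auto simp: fls_supp_def)
  then show ?thesis
    by (simp add: trig_eq_sum[of "{0}"])
qed

lemma trig_1 [simp]: "trig 1 t = 1"
  using trig_const[of 1] by simp

lemma trig_X_intpow [simp]: "trig (fls_X_intpow s) t = cis (of_int s * t)"
proof -
  have "fls_supp (fls_X_intpow s) \<subseteq> {s}"
    by (auto simp: fls_supp_def split: if_splits)
  then show ?thesis
    by (simp add: trig_eq_sum[of "{s}"])
qed

lemma trig_X [simp]: "trig fls_X t = cis t"
proof -
  have "fls_supp fls_X \<subseteq> {1}"
    by (auto simp: fls_supp_def split: if_splits)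
  then show ?thesis
    by (simp add: trig_eq_sum[of "{1}"])
qed

lemma trig_X_inv [simp]: "trig fls_X_inv t = cis (- t)"
proof -
  have "fls_supp fls_X_inv \<subseteq> {-1}"
    by (auto simp: fls_supp_def split: if_splits)
  then show ?thesis
    by (simp add: trig_eq_sum[of "{-1}"])
qed

lemma trig_mult:
  assumes "finite (fls_supp p)" "finite (fls_supp q)"
  shows "trig (p * q) t = trig p t * trig q t"
proof -
  let ?P = "fls_supp p" and ?Q = "fls_supp q"
  define S where "S = (\<lambda>(i, j). i + j) ` (?P \<times> ?Q)"
  have fin: "finite S"
    unfolding S_def using assms by auto
  have "fls_supp (p * q) \<subseteq> S"
  proof
    fix n assume "n \<in> fls_supp (p * q)"
    then obtain i where "i \<in> ?P" "p $$ i * q $$ (n - i) \<noteq> 0"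
      unfolding fls_supp_def[of "p * q"] fls_times_nth_supp[OF assms(1) subset_refl]
      by (auto elim: sum.not_neutral_contains_not_neutral)
    then show "n \<in> S"
      unfolding S_def by (auto intro!: image_eqI[of _ _ "(i, n - i)"] simp: fls_supp_def)
  qed
  then have "trig (p * q) t = (\<Sum>n\<in>S. of_real ((p * q) $$ n) * cis (of_int n * t))"
    using fin by (rule trig_eq_sum[rotated])
  also have "\<dots> = (\<Sum>n\<in>S. \<Sum>i\<in>?P. (of_real (p $$ i) * cis (of_int i * t)) *
      (of_real (q $$ (n - i)) * cis (of_int (n - i) * t)))"
    unfolding fls_times_nth_supp[OF assms(1) subset_refl] of_real_sum sum_distrib_right
  proof (intro sum.cong refl)
    fix n i
    have "cis (of_int n * t) = cis (of_int i * t) * cis (of_int (n - i) * t)"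
      by (simp add: cis_mult algebra_simps)
    then show "of_real (p $$ i * q $$ (n - i)) * cis (of_int n * t) =
      of_real (p $$ i) * cis (of_int i * t) * (of_real (q $$ (n - i)) * cis (of_int (n - i) * t))"
      by simp
  qed
  also have "\<dots> = (\<Sum>i\<in>?P. (of_real (p $$ i) * cis (of_int i * t)) *
      (\<Sum>n\<in>S. of_real (q $$ (n - i)) * cis (of_int (n - i) * t)))"
    by (subst sum.swap) (simp add: sum_distrib_left)
  also have "\<dots> = (\<Sum>i\<in>?P. (of_real (p $$ i) * cis (of_int i * t)) * trig q t)"
  proof (intro sum.cong refl)
    fix i assume i: "i \<in> ?P"
    have "(\<Sum>n\<in>S. of_real (q $$ (n - i)) * cis (of_int (n - i) * t)) =
      (\<Sum>j\<in>(\<lambda>n. n - i) ` S. of_real (q $$ j) * cis (of_int j * t))"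
      by (subst sum.reindex) (auto simp: inj_on_def)
    also have "\<dots> = trig q t"
    proof (rule trig_eq_sum[symmetric])
      show "?Q \<subseteq> (\<lambda>n. n - i) ` S"
      proof
        fix j assume "j \<in> ?Q"
        with i have "i + j \<in> S" unfolding S_def by auto
        then show "j \<in> (\<lambda>n. n - i) ` S" by (auto intro!: image_eqI[of _ _ "i + j"])
      qed
    qed (use fin in auto)
    finally show "(of_real (p $$ i) * cis (of_int i * t)) *
        (\<Sum>n\<in>S. of_real (q $$ (n - i)) * cis (of_int (n - i) * t)) =
      (of_real (p $$ i) * cis (of_int i * t)) * trig q t"
      by simp
  qed
  also have "\<dots> = trig p t * trig q t"
    by (simp add: trig_def sum_distrib_right)
  finally show ?thesis .
qed

lemma trig_power: "finite (fls_supp p) \<Longrightarrow> trig (p ^ n) t = trig p t ^ n"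
  by (induction n) (simp_all add: trig_mult finite_fls_supp_power)

lemma trig_compose_power:
  assumes "finite (fls_supp p)" "d > 0"
  shows "trig (fls_compose_power p d) t = trig p (real d * t)"
proof -
  have "fls_supp (fls_compose_power p d) \<subseteq> (\<lambda>k. int d * k) ` fls_supp p"
    using assms(2) by (auto simp: fls_supp_def fls_nth_compose_power split: if_splits)
  then have "trig (fls_compose_power p d) t = (\<Sum>k\<in>(\<lambda>k. int d * k) ` fls_supp p.
      of_real (fls_compose_power p d $$ k) * cis (of_int k * t))"
    using assms by (intro trig_eq_sum) auto
  also have "\<dots> = trig p (real d * t)"
    unfolding trig_def using assms
    by (subst sum.reindex) (auto simp: inj_on_def fls_nth_compose_power mult_ac)
  finally show ?thesis .
qed

lemma has_integral_cis:
  "((\<lambda>t. cis (of_int k * t)) has_integral (if k = 0 then 2 * of_real pi else 0)) {-pi..pi}"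
proof (cases "k = 0")
  case True
  have "((\<lambda>t. 1 :: complex) has_integral (pi - (- pi)) *\<^sub>R 1) {-pi..pi}"
    using has_integral_const_real[of "1::complex" "-pi" pi] by simp
  then show ?thesis
    using True by (simp add: scaleR_conv_of_real)
next
  case False
  let ?F = "\<lambda>t. cis (of_int k * t) / (\<i> * of_int k)"
  have "((\<lambda>t. cis (of_int k * t)) has_integral ?F pi - ?F (-pi)) {-pi..pi}"
  proof (rule fundamental_theorem_of_calculus)
    fix t :: real
    have "((\<lambda>z. exp (\<i> * of_int k * z) / (\<i> * of_int k)) has_field_derivative
        exp (\<i> * of_int k * of_real t)) (at (of_real t))"
      using False by (auto intro!: derivative_eq_intros)
    then have "((\<lambda>t. exp (\<i> * of_int k * of_real t) / (\<i> * of_int k)) has_vector_derivative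
        exp (\<i> * of_int k * of_real t)) (at t within {-pi..pi})"
      by (rule has_vector_derivative_real_field)
    then show "(?F has_vector_derivative cis (of_int k * t)) (at t within {-pi..pi})"
      by (simp add: cis_conv_exp mult_ac)
  qed simp
  moreover have "cis (of_int k * pi) = cis (of_int k * (-pi))"
  proof -
    have "cis (of_int k * pi) = cis (of_int k * (-pi) + 2 * pi * of_int k)"
      by (simp add: algebra_simps)
    also have "\<dots> = cis (of_int k * (-pi)) * cis (2 * pi * of_int k)"
      by (simp only: cis_mult)
    also have "cis (2 * pi * of_int k) = 1"
      by (rule cis_multiple_2pi) simp
    finally show ?thesis by simp
  qed
  ultimately show ?thesis
    using False by simp
qed

text \<open>Orthogonality of the characters. This is the bridge from estimates on the circle back to
  coefficients.\<close>

lemma fls_nth_integral: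
  assumes "finite (fls_supp p)"
  shows "((\<lambda>t. trig p t * cis (- of_int k * t)) has_integral of_real (2 * pi * p $$ k)) {-pi..pi}"
proof -
  have "((\<lambda>t. \<Sum>j\<in>fls_supp p. of_real (p $$ j) * cis (of_int (j - k) * t)) has_integral
      (\<Sum>j\<in>fls_supp p. of_real (p $$ j) * (if j - k = 0 then 2 * of_real pi else 0))) {-pi..pi}"
    by (intro has_integral_sum assms has_integral_mult_right has_integral_cis)
  moreover have "(\<Sum>j\<in>fls_supp p. of_real (p $$ j) * (if j - k = 0 then 2 * of_real pi else 0)) =
      (of_real (2 * pi * p $$ k) :: complex)"
    using assms fls_nth_notin_supp[of k p] by (simp add: if_distrib sum.delta cong: if_cong)
  moreover have "(\<lambda>t. \<Sum>j\<in>fls_supp p. of_real (p $$ j) * cis (of_int (j - k) * t)) =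
      (\<lambda>t. trig p t * cis (- of_int k * t))"
    by (simp add: trig_def sum_distrib_right cis_mult ring_distribs mult.assoc)
  ultimately show ?thesis
    by metis
qed

subsection \<open>Iterated refinement and decay of differences\<close>

text \<open>Generating function of the data after \<open>n\<close> refinements of the data
  \<open>G\<close>: in this language subdivision is upsampling, \<open>z\<close> to
  \<open>z^2\<close>, followed by multiplication with the symbol.\<close>

primrec level :: "real fls \<Rightarrow> real fls \<Rightarrow> nat \<Rightarrow> real fls" where
  "level a G 0 = G"
| "level a G (Suc n) = a * fls_compose_power (level a G n) 2"

lemma finite_fls_supp_level:
  "finite (fls_supp a) \<Longrightarrow> finite (fls_supp G) \<Longrightarrow> finite (fls_supp (level a G n))"
  by (induction n) (auto intro!: finite_fls_supp_mult finite_fls_supp_compose_power)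

lemma subdivide_eq_mult:
  assumes "finite (fls_supp a)"
  shows "subdivide a (fls_nth G) = fls_nth (a * fls_compose_power G 2)"
proof
  fix k
  let ?L = "{l. a $$ (k - 2 * l) \<noteq> 0}"
  have "(a * fls_compose_power G 2) $$ k = (\<Sum>i\<in>fls_supp a. a $$ i * fls_compose_power G 2 $$ (k - i))"
    by (rule fls_times_nth_supp[OF assms subset_refl])
  also have "\<dots> = (\<Sum>i\<in>(\<lambda>l. k - 2 * l) ` ?L. a $$ i * fls_compose_power G 2 $$ (k - i))"
  proof (rule sum.mono_neutral_right[OF assms])
    \<comment> \<open>Upsampled data vanish at odd places, so only indices \<open>i\<close> of the
      parity of \<open>k\<close> contribute.\<close>
    show "\<forall>i\<in>fls_supp a - (\<lambda>l. k - 2 * l) ` ?L. a $$ i * fls_compose_power G 2 $$ (k - i) = 0"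
    proof
      fix i assume i: "i \<in> fls_supp a - (\<lambda>l. k - 2 * l) ` ?L"
      have "odd (k - i)"
      proof
        assume "even (k - i)"
        then obtain l where "k - i = 2 * l" by (elim evenE)
        then have "i = k - 2 * l" by simp
        with i show False by (auto simp: fls_supp_def)
      qed
      then show "a $$ i * fls_compose_power G 2 $$ (k - i) = 0"
        by (simp add: fls_nth_compose_power)
    qed
  qed (auto simp: fls_supp_def)
  also have "\<dots> = (\<Sum>l\<in>?L. a $$ (k - 2 * l) * G $$ l)"
    by (subst sum.reindex) (auto simp: inj_on_def fls_nth_compose_power)
  finally show "subdivide a (fls_nth G) k = (a * fls_compose_power G 2) $$ k"
    by (simp add: subdivide_def)
qed

lemma subdivide_funpow_eq_level:
  "finite (fls_supp a) \<Longrightarrow> (subdivide a ^^ n) (fls_nth G) = fls_nth (level a G n)"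
  by (induction n) (simp_all add: subdivide_eq_mult)

text \<open>Here \<open>level a 1 n\<close> is the product
  \<open>a(z) a(z^2) ... a(z^(2^(n-1)))\<close>. The initial data enter only through a dilated
  factor, so growth is governed by the symbol alone.\<close>

lemma level_eq_mult: "level a G n = level a 1 n * fls_compose_power G (2 ^ n)"
  by (induction n) (simp_all add: fls_compose_power_compose_power mult_ac)

lemma level_scale: "level (fls_const x * q) G n = fls_const (x ^ n) * level q G n"
  by (induction n) (simp_all add: mult_ac flip: fls_const_mult_const)

lemma compose_power_1_minus_X: "fls_compose_power (1 - fls_X) 2 = (1 - fls_X) * (1 + fls_X :: real fls)"
proof -
  have "fls_X_intpow 2 = (fls_X ^ 2 :: real fls)"
    using fls_X_power_conv_shift_1[of 2, where ?'a = real] by simp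
  then show ?thesis
    by (simp add: power2_eq_square algebra_simps)
qed

text \<open>Since \<open>1 - z^2 = (1 - z) (1 + z)\<close>, moving \<open>(1 - z) ^ i\<close>
  through one upsampling uses up the factor \<open>(1 + z) ^ i\<close> of the symbol. Hence
  differences of refined data are themselves refined data, for the quotient
  \<open>q\<close>.\<close>

lemma level_difference:
  assumes "a = (1 + fls_X) ^ i * q"
  shows "(1 - fls_X) ^ i * level a G n = level q ((1 - fls_X) ^ i * G) n"
proof (induction n)
  case (Suc n)
  have "level q ((1 - fls_X) ^ i * G) (Suc n) = q * fls_compose_power ((1 - fls_X) ^ i * level a G n) 2"
    using Suc by simp
  also have "\<dots> = q * ((1 - fls_X) * (1 + fls_X)) ^ i * fls_compose_power (level a G n) 2"
    by (simp add: compose_power_1_minus_X del: fls_compose_power_diff)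
  also have "\<dots> = (1 - fls_X) ^ i * level a G (Suc n)"
    by (simp add: assms power_mult_distrib mult_ac)
  finally show ?case ..
qed simp

lemma abs_fls_nth_le_sum:
  assumes "finite (fls_supp p)"
  shows "\<bar>p $$ k\<bar> \<le> (\<Sum>j\<in>fls_supp p. \<bar>p $$ j\<bar>)"
proof (cases "k \<in> fls_supp p")
  case True
  then show ?thesis
    using assms by (intro member_le_sum) auto
qed (simp add: fls_nth_notin_supp sum_nonneg)

lemma sum_abs_compose_power:
  assumes "d > 0"
  shows "(\<Sum>j\<in>fls_supp (fls_compose_power p d). \<bar>fls_compose_power p d $$ j\<bar>) = (\<Sum>j\<in>fls_supp p. \<bar>p $$ j\<bar>)"
proof -
  have "fls_supp (fls_compose_power p d) = (\<lambda>k. int d * k) ` fls_supp p"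
    using assms by (auto simp: fls_supp_def fls_nth_compose_power split: if_splits)
  moreover have "inj_on (\<lambda>k. int d * k) (fls_supp p)"
    using assms by (auto simp: inj_on_def)
  ultimately show ?thesis
    using assms by (simp add: sum.reindex fls_nth_compose_power)
qed

lemma fls_nth_diff_le:
  assumes "\<And>k. \<bar>((1 - fls_X) * F) $$ k\<bar> \<le> E"
  shows "\<bar>F $$ i - F $$ j\<bar> \<le> \<bar>of_int (i - j)\<bar> * (E::real)"
proof -
  have d: "\<bar>F $$ k - F $$ (k - 1)\<bar> \<le> E" for k
    using assms[of k] by (simp add: left_diff_distrib fls_X_times_conv_shift)
  have *: "\<bar>F $$ (j + int n) - F $$ j\<bar> \<le> real n * E" for n j
  proof (induction n)
    case (Suc n)
    have "\<bar>F $$ (j + int (Suc n)) - F $$ (j + int n)\<bar> \<le> E"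
      using d[of "j + int (Suc n)"] by (simp add: algebra_simps)
    then show ?case
      using Suc by (simp add: ring_distribs)
  qed simp
  show ?thesis
  proof (cases "j \<le> i")
    case True
    then show ?thesis
      using *[of j "nat (i - j)"] by simp
  next
    case False
    then show ?thesis
      using *[of i "nat (j - i)"] by (simp add: abs_minus_commute)
  qed
qed

text \<open>The factor \<open>1 + z\<close> turns upsampling into duplication of every entry; convolution with \<open>r\<close>
  then only mixes neighbouring entries.\<close>

lemma refine_close_to_duplicate:
  assumes "finite (fls_supp r)" "\<And>k. \<bar>((1 - fls_X) * F) $$ k\<bar> \<le> E"
  shows "\<bar>((1 + fls_X) * r * fls_compose_power F 2) $$ k - (\<Sum>j\<in>fls_supp r. r $$ j) * F $$ (k div 2)\<bar>
    \<le> (\<Sum>j\<in>fls_supp r. \<bar>r $$ j\<bar> * \<bar>of_int j\<bar>) * (E::real)"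
proof -
  have E: "0 \<le> E"
    using assms(2)[of 0] by linarith
  have dup: "((1 + fls_X) * fls_compose_power F 2) $$ k = F $$ (k div 2)" for k
  proof (cases "even k")
    case False
    then have "(k - 1) div 2 = k div 2" by presburger
    then show ?thesis using False
      by (simp add: distrib_right fls_X_times_conv_shift fls_nth_compose_power)
  qed (simp add: distrib_right fls_X_times_conv_shift fls_nth_compose_power)
  have eq: "(1 + fls_X) * r * fls_compose_power F 2 = r * ((1 + fls_X) * fls_compose_power F 2)"
    by (simp only: mult_ac)
  have "((1 + fls_X) * r * fls_compose_power F 2) $$ k - (\<Sum>j\<in>fls_supp r. r $$ j) * F $$ (k div 2)
      = (\<Sum>j\<in>fls_supp r. r $$ j * (F $$ ((k - j) div 2) - F $$ (k div 2)))"
    unfolding eq fls_times_nth_supp[OF assms(1) subset_refl] dup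
    by (simp add: sum_distrib_right right_diff_distrib sum_subtractf)
  also have "\<bar>\<dots>\<bar> \<le> (\<Sum>j\<in>fls_supp r. \<bar>r $$ j * (F $$ ((k - j) div 2) - F $$ (k div 2))\<bar>)"
    by (rule sum_abs)
  also have "\<dots> \<le> (\<Sum>j\<in>fls_supp r. \<bar>r $$ j\<bar> * \<bar>of_int j\<bar> * E)"
  proof (rule sum_mono)
    fix j
    have "\<bar>(k - j) div 2 - k div 2\<bar> \<le> \<bar>j\<bar>"
    proof (cases "j = 0")
      case False
      have "2 * ((k - j) div 2) \<le> k - j" "k - j \<le> 2 * ((k - j) div 2) + 1"
        "2 * (k div 2) \<le> k" "k \<le> 2 * (k div 2) + 1"
        by simp_all
      with False show ?thesis by linarith
    qed simp
    then have le: "\<bar>of_int ((k - j) div 2 - k div 2)\<bar> \<le> \<bar>of_int j :: real\<bar>"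
      by linarith
    have "\<bar>F $$ ((k - j) div 2) - F $$ (k div 2)\<bar> \<le> \<bar>of_int ((k - j) div 2 - k div 2)\<bar> * E"
      by (rule fls_nth_diff_le[OF assms(2)])
    also have "\<dots> \<le> \<bar>of_int j\<bar> * E"
      by (rule mult_right_mono[OF le E])
    finally show "\<bar>r $$ j * (F $$ ((k - j) div 2) - F $$ (k div 2))\<bar> \<le> \<bar>r $$ j\<bar> * \<bar>of_int j\<bar> * E"
      unfolding abs_mult mult.assoc by (rule mult_left_mono) simp
  qed
  finally show ?thesis
    by (simp add: sum_distrib_right)
qed

lemma trig_0: "trig r 0 = of_real (\<Sum>j\<in>fls_supp r. r $$ j)"
  by (simp add: trig_def)

text \<open>\<open>N\<close> is a parameter of its own because differentiating the limit function
  lowers \<open>N\<close> and keeps \<open>c\<close>. For \<open>N = 0\<close> the symbol is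
  \<open>2 c\<close>.\<close>

definition smoothed :: "nat \<Rightarrow> real fls \<Rightarrow> real fls" where
  "smoothed N c = fls_const (2 / 2 ^ N) * (1 + fls_X) ^ N * c"

lemma finite_fls_supp_smoothed: "finite (fls_supp c) \<Longrightarrow> finite (fls_supp (smoothed N c))"
  unfolding smoothed_def by (intro finite_fls_supp_intros)

lemma smoothed_split:
  assumes "i \<le> N"
  shows "smoothed N c = (1 + fls_X) ^ i * (fls_const (1 / 2 ^ i) * smoothed (N - i) c)"
proof -
  have "(1 + fls_X) ^ N = (1 + fls_X) ^ i * (1 + fls_X :: real fls) ^ (N - i)"
    using assms by (simp flip: power_add)
  moreover have "fls_const (2 / 2 ^ N) = fls_const (1 / 2 ^ i) * fls_const (2 / 2 ^ (N - i) :: real)"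
    using assms by (simp add: fls_const_mult_const flip: power_add)
  ultimately show ?thesis
    unfolding smoothed_def by (simp only: mult_ac)
qed

text \<open>The factor \<open>(1 / 2 ^ i) ^ n\<close> is the \<open>i\<close>-th power of the mesh
  width \<open>1 / 2 ^ n\<close>: divided differences of order \<open>i\<close> obey the scheme with
  \<open>N - i\<close> in place of \<open>N\<close>.\<close>

lemma smoothed_difference:
  assumes "i \<le> N"
  shows "(1 - fls_X) ^ i * level (smoothed N c) G n =
    fls_const ((1 / 2 ^ i) ^ n) * level (smoothed (N - i) c) ((1 - fls_X) ^ i * G) n"
  unfolding level_difference[OF smoothed_split[OF assms]] level_scale ..

text \<open>The integer \<open>s\<close> records the centre of the symbol. The bound \<beta> \<ge> 1
  permits dropping factors when a product is bounded from below; the normalization at 0 makes the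
  scheme reproduce constants once \<open>1 \<le> N\<close>.\<close>

locale trig_symbol =
  fixes c :: "real fls" and \<beta> :: "real \<Rightarrow> real" and s :: int
  assumes fin: "finite (fls_supp c)"
    and trig_c: "trig c t = cis (- of_int s * t) * of_real (\<beta> t)"
    and ge1: "1 \<le> \<beta> t"
    and one: "\<beta> 0 = 1"
    and cont: "continuous_on UNIV \<beta>"
begin

text \<open>The mean value of the product, times \<open>2 * pi\<close>.\<close>

definition mass :: "nat \<Rightarrow> real" where
  "mass n = integral {-pi..pi} (\<lambda>t. \<Prod>i<n. \<beta> (2 ^ i * t))"

lemma cont_prod: "continuous_on A (\<lambda>t. \<Prod>i<n. \<beta> (x * 2 ^ i * t))"
  by (intro continuous_on_prod continuous_on_compose2[OF cont] continuous_intros) auto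

lemma has_integral_mass: "((\<lambda>t. \<Prod>i<n. \<beta> (2 ^ i * t)) has_integral mass n) {-pi..pi}"
  unfolding mass_def
  using cont_prod[where A = "{-pi..pi}" and n = n and x = 1] by (intro integrable_integral integrable_continuous_real) simp

lemma prod_ge1: "1 \<le> (\<Prod>i<n. \<beta> (f i))"
  by (rule prod_ge_1) (rule ge1)

lemma mass_ge: "2 * pi \<le> mass n"
proof -
  have "((\<lambda>t. 1::real) has_integral 2 * pi) {-pi..pi}"
    using has_integral_const_real[of "1::real" "-pi" pi] by simp
  then show ?thesis
    by (rule has_integral_le[OF _ has_integral_mass]) (rule prod_ge1)
qed

text \<open>The phases add up to \<open>s * (1 + 2 + ... + 2 ^ (n - 1))\<close>, a geometric sum;
  this locates the central coefficient.\<close>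

lemma trig_level:
  "trig (level c 1 n) t = cis (- of_int (s * (2 ^ n - 1)) * t) * of_real (\<Prod>i<n. \<beta> (2 ^ i * t))"
proof (induction n arbitrary: t)
  case (Suc n)
  have "finite (fls_supp (level c 1 n))"
    by (intro finite_fls_supp_level fin) simp
  then have "trig (level c 1 (Suc n)) t = trig c t * trig (level c 1 n) (2 * t)"
    by (simp add: trig_mult fin finite_fls_supp_compose_power trig_compose_power)
  also have "\<dots> = (cis (- of_int s * t) * cis (- of_int (s * (2 ^ n - 1)) * (2 * t))) *
      of_real (\<beta> t * (\<Prod>i<n. \<beta> (2 ^ i * (2 * t))))"
    by (simp add: Suc trig_c mult_ac)
  also have "cis (- of_int s * t) * cis (- of_int (s * (2 ^ n - 1)) * (2 * t)) =
      cis (- of_int (s * (2 ^ Suc n - 1)) * t)"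
    by (simp add: cis_mult algebra_simps)
  also have "\<beta> t * (\<Prod>i<n. \<beta> (2 ^ i * (2 * t))) = (\<Prod>i<Suc n. \<beta> (2 ^ i * t))"
    by (simp add: prod.lessThan_Suc_shift mult_ac del: prod.lessThan_Suc)
  finally show ?case .
qed simp

lemma abs_level_nth_le: "\<bar>level c 1 n $$ k\<bar> \<le> mass n"
proof -
  have "finite (fls_supp (level c 1 n))"
    by (intro finite_fls_supp_level fin) simp
  then have "((\<lambda>t. trig (level c 1 n) t * cis (- of_int k * t)) has_integral
      of_real (2 * pi * level c 1 n $$ k)) {-pi..pi}"
    by (rule fls_nth_integral)
  moreover have "norm (integral {-pi..pi} (\<lambda>t. trig (level c 1 n) t * cis (- of_int k * t))) \<le> mass n"
    unfolding mass_def
  proof (rule integral_norm_bound_integral)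
    show "norm (trig (level c 1 n) t * cis (- of_int k * t)) \<le> (\<Prod>i<n. \<beta> (2 ^ i * t))" for t
      using prod_ge1[of "\<lambda>i. 2 ^ i * t" n] by (simp add: trig_level norm_mult del: of_real_prod)
  qed (use calculation has_integral_mass in blast)+
  ultimately have "2 * pi * \<bar>level c 1 n $$ k\<bar> \<le> mass n"
    by (simp add: integral_unique norm_mult)
  \<comment> \<open>The factor \<open>1 / (2 * pi)\<close> is given away, as constants do not affect
    the growth rate.\<close>
  moreover have "1 * \<bar>level c 1 n $$ k\<bar> \<le> 2 * pi * \<bar>level c 1 n $$ k\<bar>"
    by (rule mult_right_mono) (use pi_ge_two in auto)
  ultimately show ?thesis by linarith
qed

lemma smoothed_factor:
  assumes "1 \<le> N"
  obtains r where "finite (fls_supp r)" "smoothed N c = (1 + fls_X) * r" "trig r 0 = 1"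
proof
  let ?r = "fls_const (2 / 2 ^ N) * (1 + fls_X) ^ (N - 1) * c"
  show "finite (fls_supp ?r)"
    by (intro finite_fls_supp_intros fin)
  have N: "N = Suc (N - 1)"
    using assms by simp
  then have "(1 + fls_X) ^ N = (1 + fls_X) * (1 + fls_X :: real fls) ^ (N - 1)"
    by (metis power_Suc)
  then show "smoothed N c = (1 + fls_X) * ?r"
    unfolding smoothed_def by (simp only: mult_ac)
  have "2 ^ N = 2 * (2::complex) ^ (N - 1)"
    using N by (metis power_Suc)
  then show "trig ?r 0 = 1"
    by (simp add: trig_mult trig_power trig_add finite_fls_supp_intros fin trig_c one)
qed

lemma top_difference:
  "(1 - fls_X) ^ N * level (smoothed N c) G n = fls_const ((1 / 2 ^ N) ^ n * 2 ^ n) *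
    (level c 1 n * fls_compose_power ((1 - fls_X) ^ N * G) (2 ^ n))"
proof -
  let ?H = "(1 - fls_X) ^ N * G"
  have "smoothed 0 c = fls_const 2 * c"
    by (simp add: smoothed_def del: fls_const_numeral)
  then have "level (smoothed 0 c) ?H n = fls_const (2 ^ n) * (level c 1 n * fls_compose_power ?H (2 ^ n))"
    using level_scale[of 2 c ?H n] level_eq_mult[of c ?H n] by simp
  then show ?thesis
    using smoothed_difference[OF order_refl, of N c G n]
    by (simp add: mult.assoc del: fls_compose_power_mult flip: fls_const_mult_const)
qed

text \<open>Young's inequality for the convolution with the dilated initial difference
  \<open>H\<close>, whose sum of absolute coefficients \<open>M\<close> is the same at every
  level.\<close>

lemma top_difference_decay:
  fixes \<nu> K :: real
  assumes G: "finite (fls_supp G)" and m: "\<And>n. mass n \<le> K * (2 ^ N / 2 * \<nu>) ^ n"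
  shows "\<exists>C. \<forall>n k. \<bar>((1 - fls_X) ^ N * level (smoothed N c) G n) $$ k\<bar> \<le> C * \<nu> ^ n"
proof (intro exI allI)
  fix n k
  define H where "H = (1 - fls_X) ^ N * G"
  have H: "finite (fls_supp H)"
    unfolding H_def by (intro finite_fls_supp_intros G)
  define M where "M = (\<Sum>j\<in>fls_supp H. \<bar>H $$ j\<bar>)"
  have "(1 - fls_X) ^ N * level (smoothed N c) G n =
      fls_const ((1 / 2 ^ N) ^ n * 2 ^ n) * (level c 1 n * fls_compose_power H (2 ^ n))"
    unfolding H_def by (rule top_difference)
  then have "\<bar>((1 - fls_X) ^ N * level (smoothed N c) G n) $$ k\<bar> =
      (1 / 2 ^ N) ^ n * 2 ^ n * \<bar>(fls_compose_power H (2 ^ n) * level c 1 n) $$ k\<bar>"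
    by (simp add: abs_mult mult.commute)
  also have "\<bar>(fls_compose_power H (2 ^ n) * level c 1 n) $$ k\<bar> \<le> M * mass n"
    unfolding M_def
    using abs_fls_times_nth_le[of "fls_compose_power H (2 ^ n)" "level c 1 n" k "mass n"]
    by (simp add: finite_fls_supp_compose_power H abs_level_nth_le sum_abs_compose_power)
  also have "\<dots> \<le> M * (K * (2 ^ N / 2 * \<nu>) ^ n)"
    by (intro mult_left_mono m) (simp add: M_def sum_nonneg)
  also have "(1 / 2 ^ N) ^ n * 2 ^ n * (M * (K * (2 ^ N / 2 * \<nu>) ^ n)) = M * K * \<nu> ^ n"
    by (simp add: power_mult_distrib power_divide)
  finally show "\<bar>((1 - fls_X) ^ N * level (smoothed N c) G n) $$ k\<bar> \<le> M * K * \<nu> ^ n"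
    by simp
qed

text \<open>Descent from order \<open>N\<close> to order \<open>i\<close>. A refined
  \<open>i\<close>-th difference is \<open>1 / 2 ^ i\<close> times its parent plus an error
  controlled by differences of order \<open>i + 1\<close>, which already decay like
  \<open>\<nu> ^ n\<close>. For \<open>1 \<le> i\<close> the factor is at most
  \<open>1 / 2 < \<nu>\<close>, so the recursion keeps the rate \<nu>.\<close>

lemma difference_decay:
  fixes \<nu> K :: real
  assumes G: "finite (fls_supp G)" and m: "\<And>n. mass n \<le> K * (2 ^ N / 2 * \<nu>) ^ n"
    and \<nu>: "1 / 2 < \<nu>" and i: "1 \<le> i" "i \<le> N"
  shows "\<exists>C. \<forall>n k. \<bar>((1 - fls_X) ^ i * level (smoothed N c) G n) $$ k\<bar> \<le> C * \<nu> ^ n"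
  using i(2,1)
proof (induction i rule: inc_induct)
  case base
  show ?case
    by (rule top_difference_decay[OF G m])
next
  case (step i)
  let ?D = "\<lambda>i n. (1 - fls_X) ^ i * level (smoothed N c) G n"
  from step obtain C where C: "\<bar>?D (Suc i) n $$ k\<bar> \<le> C * \<nu> ^ n" for n k
    by auto
  obtain r0 where r0: "finite (fls_supp r0)" "smoothed (N - i) c = (1 + fls_X) * r0" "trig r0 0 = 1"
  proof (rule smoothed_factor)
    show "1 \<le> N - i"
      using step.hyps by simp
  qed
  define r where "r = fls_const (1 / 2 ^ i) * r0"
  have r: "finite (fls_supp r)"
    unfolding r_def by (intro finite_fls_supp_intros r0)
  have q: "fls_const (1 / 2 ^ i) * smoothed (N - i) c = (1 + fls_X) * r"
    unfolding r0 r_def by (simp only: mult_ac)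
  have "complex_of_real (\<Sum>j\<in>fls_supp r. r $$ j) = of_real (1 / 2 ^ i)"
    unfolding trig_0[symmetric] r_def by (simp add: trig_mult r0)
  then have r1: "(\<Sum>j\<in>fls_supp r. r $$ j) = 1 / 2 ^ i"
    by (simp only: of_real_eq_iff)
  have L: "?D i n = level ((1 + fls_X) * r) ((1 - fls_X) ^ i * G) n" for n
    unfolding level_difference[OF smoothed_split[OF less_imp_le[OF step.hyps(2)]]] q ..
  have recur: "?D i (Suc n) = (1 + fls_X) * r * fls_compose_power (?D i n) 2" for n
    unfolding L unfolding level.simps ..
  define R where "R = (\<Sum>j\<in>fls_supp r. \<bar>r $$ j\<bar> * \<bar>of_int j\<bar>)"
  have le_half: "1 / 2 ^ i \<le> (1 / 2 :: real)"
    using step.prems by (auto simp: field_simps intro: self_le_power)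
  define B where "B = (\<Sum>j\<in>fls_supp (?D i 0). \<bar>?D i 0 $$ j\<bar>)"
  \<comment> \<open>The second entry solves \<open>R * C + C' / 2 ^ i = C' * \<nu>\<close>, which
    closes the induction on \<open>n\<close>; the first covers level 0.\<close>
  define C' where "C' = max B (R * C / (\<nu> - 1 / 2 ^ i))"
  have C': "R * C \<le> C' * (\<nu> - 1 / 2 ^ i)"
  proof -
    have "0 < \<nu> - 1 / 2 ^ i"
      using \<nu> le_half by linarith
    then have "R * C = R * C / (\<nu> - 1 / 2 ^ i) * (\<nu> - 1 / 2 ^ i)"
      by simp
    also have "\<dots> \<le> C' * (\<nu> - 1 / 2 ^ i)"
      using \<open>0 < \<nu> - 1 / 2 ^ i\<close> unfolding C'_def by (intro mult_right_mono) auto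
    finally show ?thesis .
  qed
  have "\<bar>?D i n $$ k\<bar> \<le> C' * \<nu> ^ n" for n k
  proof (induction n arbitrary: k)
    case 0
    have "finite (fls_supp (?D i 0))"
      using G by (simp add: finite_fls_supp_intros)
    then have "\<bar>?D i 0 $$ k\<bar> \<le> B"
      unfolding B_def by (rule abs_fls_nth_le_sum)
    then show ?case by (simp add: C'_def)
  next
    case (Suc n)
    have D: "\<bar>((1 - fls_X) * ?D i n) $$ k\<bar> \<le> C * \<nu> ^ n" for k
      using C[of n k] by (simp add: mult.assoc)
    have "\<bar>?D i (Suc n) $$ k - 1 / 2 ^ i * ?D i n $$ (k div 2)\<bar> \<le> R * (C * \<nu> ^ n)"
      using refine_close_to_duplicate[OF r D, of k] unfolding recur R_def r1 .
    moreover have "\<bar>1 / 2 ^ i * ?D i n $$ (k div 2)\<bar> \<le> 1 / 2 ^ i * (C' * \<nu> ^ n)"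
      unfolding abs_mult using Suc[of "k div 2"] by (simp add: divide_right_mono)
    ultimately have "\<bar>?D i (Suc n) $$ k\<bar> \<le> R * C * \<nu> ^ n + 1 / 2 ^ i * C' * \<nu> ^ n"
      by linarith
    also have "\<dots> \<le> C' * (\<nu> - 1 / 2 ^ i) * \<nu> ^ n + 1 / 2 ^ i * C' * \<nu> ^ n"
      using C' \<nu> by (intro add_right_mono mult_right_mono) auto
    also have "\<dots> = C' * \<nu> ^ Suc n"
      by (simp add: algebra_simps)
    finally show ?case .
  qed
  then show ?case by blast
qed

end

subsection \<open>Convergence of the scheme\<close>

lemma linear_interp_eq:
  "linear_interp j g x = g \<lfloor>2 ^ j * x\<rfloor> + frac (2 ^ j * x) * (g (\<lfloor>2 ^ j * x\<rfloor> + 1) - g \<lfloor>2 ^ j * x\<rfloor>)"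
  by (simp add: linear_interp_def algebra_simps)

lemma linear_interp_close:
  assumes "\<And>k. \<bar>g k - g (k - 1)\<bar> \<le> E"
  shows "\<bar>linear_interp j g x - g \<lfloor>2 ^ j * x\<rfloor>\<bar> \<le> E"
proof -
  let ?m = "\<lfloor>2 ^ j * x\<rfloor>"
  have "\<bar>linear_interp j g x - g ?m\<bar> = frac (2 ^ j * x) * \<bar>g (?m + 1) - g ?m\<bar>"
    by (simp add: linear_interp_eq abs_mult)
  also have "\<dots> \<le> 1 * \<bar>g (?m + 1) - g ?m\<bar>"
    by (intro mult_right_mono) (auto simp: frac_lt_1 less_imp_le)
  also have "\<dots> \<le> E"
    using assms[of "?m + 1"] by simp
  finally show ?thesis .
qed

text \<open>Slopes are bounded only on the cells between \<open>x\<close> and \<open>y\<close>. This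
  local form is used later on data from which a linear function has been subtracted that fits only
  near \<open>x\<close> and \<open>y\<close>.\<close>

lemma linear_interp_lipschitz:
  assumes "x \<le> y" "\<And>k. \<lfloor>2 ^ j * x\<rfloor> \<le> k \<Longrightarrow> k \<le> \<lfloor>2 ^ j * y\<rfloor> \<Longrightarrow> \<bar>g (k + 1) - g k\<bar> \<le> E"
  shows "\<bar>linear_interp j g y - linear_interp j g x\<bar> \<le> 2 ^ j * E * (y - x)"
proof -
  \<comment> \<open>In the coordinate \<open>u = 2 ^ j * x\<close> the cells have length 1, and the
    induction runs over the number of integers crossed.\<close>
  define h where "h u = g \<lfloor>u\<rfloor> + frac u * (g (\<lfloor>u\<rfloor> + 1) - g \<lfloor>u\<rfloor>)" for u :: real
  have "\<bar>h w - h u\<bar> \<le> E * (w - u)"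
    if "\<lfloor>w\<rfloor> = \<lfloor>u\<rfloor> + int d" "u \<le> w" "\<And>k. \<lfloor>u\<rfloor> \<le> k \<Longrightarrow> k \<le> \<lfloor>w\<rfloor> \<Longrightarrow> \<bar>g (k + 1) - g k\<bar> \<le> E" for u w d
    using that
  proof (induction d arbitrary: u)
    case 0
    then have "h w - h u = (g (\<lfloor>u\<rfloor> + 1) - g \<lfloor>u\<rfloor>) * (w - u)"
      by (simp add: h_def frac_def algebra_simps)
    then have "\<bar>h w - h u\<bar> = \<bar>g (\<lfloor>u\<rfloor> + 1) - g \<lfloor>u\<rfloor>\<bar> * (w - u)"
      using 0 by (simp add: abs_mult)
    then show ?case
      using 0 by (simp add: mult_right_mono)
  next
    case (Suc d)
    define u' :: real where "u' = of_int (\<lfloor>u\<rfloor> + 1)"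
    have u': "\<lfloor>u'\<rfloor> = \<lfloor>u\<rfloor> + 1" "u \<le> u'" "u' \<le> w"
      using Suc.prems(1) unfolding u'_def by linarith+
    have "h u' - h u = (g (\<lfloor>u\<rfloor> + 1) - g \<lfloor>u\<rfloor>) * (u' - u)"
      unfolding h_def u' by (simp add: u'_def frac_def algebra_simps)
    then have "\<bar>h u' - h u\<bar> = \<bar>g (\<lfloor>u\<rfloor> + 1) - g \<lfloor>u\<rfloor>\<bar> * (u' - u)"
      using u' by (simp add: abs_mult)
    also have "\<dots> \<le> E * (u' - u)"
      using Suc.prems u' by (intro mult_right_mono) auto
    finally have "\<bar>h u' - h u\<bar> \<le> E * (u' - u)" .
    moreover have "\<bar>h w - h u'\<bar> \<le> E * (w - u')"
      by (rule Suc.IH) (use Suc.prems u' in auto)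
    moreover have "E * (w - u) = E * (w - u') + E * (u' - u)"
      by (simp add: algebra_simps)
    ultimately show ?case by linarith
  qed
  from this[of "2 ^ j * y" "2 ^ j * x" "nat (\<lfloor>2 ^ j * y\<rfloor> - \<lfloor>2 ^ j * x\<rfloor>)"]
  have "\<bar>h (2 ^ j * y) - h (2 ^ j * x)\<bar> \<le> E * (2 ^ j * y - 2 ^ j * x)"
    using assms by (simp add: floor_mono)
  then show ?thesis
    by (simp add: h_def linear_interp_eq algebra_simps)
qed

lemma linear_interp_refine_close:
  assumes "\<And>k. \<bar>f k - f (k - 1)\<bar> \<le> E" "\<And>k. \<bar>g k - g (k - 1)\<bar> \<le> E'"
    and "\<And>k. \<bar>g k - f (k div 2)\<bar> \<le> D"
  shows "\<bar>linear_interp (Suc j) g x - linear_interp j f x\<bar> \<le> E + E' + D"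
proof -
  have "\<lfloor>2 ^ Suc j * x\<rfloor> div 2 = \<lfloor>2 ^ j * x\<rfloor>"
    using floor_divide_of_int_eq[of 2 1] floor_divide_real_eq_div[of 2 "2 ^ Suc j * x"] by simp
  then show ?thesis
    using linear_interp_close[of f E j x] linear_interp_close[of g E' "Suc j" x] assms
      assms(3)[of "\<lfloor>2 ^ Suc j * x\<rfloor>"] by (auto simp: abs_le_iff)
qed

lemma geometric_steps_convergent:
  fixes a :: "nat \<Rightarrow> real"
  assumes \<nu>: "0 \<le> \<nu>" "\<nu> < 1" and step: "\<And>n. \<bar>a (Suc n) - a n\<bar> \<le> K * \<nu> ^ n"
  shows "convergent a" "\<bar>lim a - a n\<bar> \<le> K / (1 - \<nu>) * \<nu> ^ n"
proof -
  have sg: "summable (\<lambda>i. K * \<nu> ^ i)"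
    using \<nu> by (intro summable_mult summable_geometric) auto
  have s: "summable (\<lambda>i. a (Suc i) - a i)"
    by (rule summable_comparison_test'[OF sg]) (use step in auto)
  then have "(\<lambda>n. a 0 + (\<Sum>i<n. a (Suc i) - a i)) \<longlonglongrightarrow> a 0 + (\<Sum>i. a (Suc i) - a i)"
    by (intro tendsto_intros summable_LIMSEQ)
  then have lim: "a \<longlonglongrightarrow> a 0 + (\<Sum>i. a (Suc i) - a i)"
    by (simp add: sum_lessThan_telescope)
  then show "convergent a"
    by (rule convergentI)
  have sgn: "summable (\<lambda>i. K * \<nu> ^ n * \<nu> ^ i)"
    using \<nu> by (intro summable_mult summable_geometric) auto
  have "lim a - a n = (\<Sum>i. a (Suc (i + n)) - a (i + n))"
    using suminf_split_initial_segment[OF s, of n] limI[OF lim] by (simp add: sum_lessThan_telescope)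
  also have "\<bar>\<dots>\<bar> \<le> (\<Sum>i. K * \<nu> ^ n * \<nu> ^ i)"
  proof -
    have "norm (a (Suc (i + n)) - a (i + n)) \<le> K * \<nu> ^ n * \<nu> ^ i" for i
      using step[of "i + n"] by (simp add: power_add mult_ac)
    from norm_suminf_le[OF this sgn] show ?thesis
      by simp
  qed
  also have "\<dots> = K / (1 - \<nu>) * \<nu> ^ n"
    using \<nu> by (simp add: suminf_mult suminf_geometric summable_geometric)
  finally show "\<bar>lim a - a n\<bar> \<le> K / (1 - \<nu>) * \<nu> ^ n" .
qed

section \<open>Hoelder continuity from dyadic approximation\<close>

lemma dyadic_scale:
  assumes "0 < d" "d \<le> (1::real)"
  obtains n where "(1 / 2) ^ Suc n < d" "d \<le> (1 / 2) ^ n"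
proof -
  define m where "m = (LEAST n. (1 / 2) ^ n < d)"
  have ex: "\<exists>n. (1 / 2) ^ n < d"
    using assms(1) by (intro real_arch_pow_inv) auto
  then have m: "(1 / 2) ^ m < d"
    unfolding m_def by (rule LeastI_ex)
  then have "m \<noteq> 0"
    using assms by (intro notI) simp
  then obtain n where n: "m = Suc n"
    by (cases m) auto
  then have "\<not> (1 / 2) ^ n < d"
    unfolding m_def using not_less_Least[of n "\<lambda>n. (1 / 2) ^ n < d"] by simp
  with m n that show ?thesis by simp
qed

text \<open>Choose \<open>n\<close> with \<open>2 ^ n\<close> comparable to
  \<open>1 / \<bar>x - y\<bar>\<close>: then the approximation error and the variation of
  \<open>L n\<close> between \<open>x\<close> and \<open>y\<close> are both of order
  \<open>2 powr (- \<alpha> * n)\<close>, that is \<open>\<bar>x - y\<bar> powr \<alpha>\<close>.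
  Distances above 1 are handled by boundedness.\<close>

lemma holder_of_approximation:
  fixes f :: "real \<Rightarrow> real" and L :: "nat \<Rightarrow> real \<Rightarrow> real"
  defines "\<nu> \<equiv> \<lambda>\<alpha>. 2 powr (- \<alpha>)"
  assumes \<alpha>: "0 < \<alpha>" and approx: "\<And>n x. \<bar>f x - L n x\<bar> \<le> K * \<nu> \<alpha> ^ n"
    and lip: "\<And>n x y. \<bar>L n x - L n y\<bar> \<le> C * \<nu> \<alpha> ^ n * 2 ^ n * \<bar>x - y\<bar>"
    and bdd: "\<And>x. \<bar>f x\<bar> \<le> B"
  shows "\<exists>C. \<forall>x y. \<bar>f x - f y\<bar> \<le> C * \<bar>x - y\<bar> powr \<alpha>"
proof (intro exI allI)
  fix x y :: real
  \<comment> \<open>The first entry serves distances above 1; in the second,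
    \<open>2 powr \<alpha>\<close> pays for rounding the distance to a power of two.\<close>
  define M where "M = max (2 * B) ((2 * K + C) * 2 powr \<alpha>)"
  have K: "0 \<le> K"
    using approx[of 0 0] by simp
  have C: "0 \<le> C"
    using lip[of 0 1 0] by simp
  consider "x = y" | "x \<noteq> y" "\<bar>x - y\<bar> \<le> 1" | "1 < \<bar>x - y\<bar>" by (meson not_less)
  then show "\<bar>f x - f y\<bar> \<le> M * \<bar>x - y\<bar> powr \<alpha>"
  proof cases
    case 2
    then obtain n where n: "(1 / 2) ^ Suc n < \<bar>x - y\<bar>" "\<bar>x - y\<bar> \<le> (1 / 2) ^ n"
      using dyadic_scale[of "\<bar>x - y\<bar>"] by auto
    have pw: "\<nu> \<alpha> ^ m = ((1 / 2) ^ m) powr \<alpha>" for m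
    proof -
      have "\<nu> \<alpha> = (1 / 2) powr \<alpha>"
        by (simp add: \<nu>_def powr_minus powr_divide inverse_eq_divide)
      moreover have "0 < (1 / 2 :: real)" by simp
      ultimately show ?thesis
        by (simp add: powr_powr mult.commute flip: powr_realpow)
    qed
    have "\<nu> \<alpha> ^ n = 2 powr \<alpha> * \<nu> \<alpha> ^ Suc n"
      unfolding \<nu>_def by (simp flip: powr_add mult.assoc)
    also have "\<nu> \<alpha> ^ Suc n \<le> \<bar>x - y\<bar> powr \<alpha>"
      unfolding pw using n \<alpha> by (intro powr_mono2) auto
    finally have \<nu>: "\<nu> \<alpha> ^ n \<le> 2 powr \<alpha> * \<bar>x - y\<bar> powr \<alpha>"
      by simp
    have "\<bar>L n x - L n y\<bar> \<le> C * \<nu> \<alpha> ^ n * 2 ^ n * \<bar>x - y\<bar>"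
      by (rule lip)
    also have "\<dots> \<le> C * \<nu> \<alpha> ^ n * 2 ^ n * (1 / 2) ^ n"
      using n C by (intro mult_left_mono) (auto simp: \<nu>_def)
    also have "\<dots> = C * \<nu> \<alpha> ^ n"
      by (simp add: power_one_over)
    finally have "\<bar>f x - f y\<bar> \<le> (2 * K + C) * \<nu> \<alpha> ^ n"
      using approx[of x n] approx[of y n] by (simp add: algebra_simps abs_le_iff)
    also have "\<dots> \<le> (2 * K + C) * (2 powr \<alpha> * \<bar>x - y\<bar> powr \<alpha>)"
      using \<nu> K C by (intro mult_left_mono) auto
    also have "\<dots> \<le> M * \<bar>x - y\<bar> powr \<alpha>"
      unfolding mult.assoc[symmetric] M_def by (intro mult_right_mono) auto
    finally show ?thesis .
  next
    case 3
    have "\<bar>f x - f y\<bar> \<le> M * 1"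
      using bdd[of x] bdd[of y] by (auto simp: M_def)
    also have "\<dots> \<le> M * \<bar>x - y\<bar> powr \<alpha>"
      using 3 \<alpha> bdd[of 0] by (intro mult_left_mono ge_one_powr_ge_zero) (auto simp: M_def)
    finally show ?thesis .
  qed simp
qed

context trig_symbol
begin

definition limit :: "nat \<Rightarrow> real fls \<Rightarrow> real \<Rightarrow> real" where
  "limit N G = limit_fun (smoothed N c) (fls_nth G)"

definition approx :: "nat \<Rightarrow> real fls \<Rightarrow> nat \<Rightarrow> real \<Rightarrow> real" where
  "approx N G n = linear_interp n (fls_nth (level (smoothed N c) G n))"

lemma scheme_fun_eq: "scheme_fun (smoothed N c) (fls_nth G) n = approx N G n"
  by (simp add: scheme_fun_def approx_def subdivide_funpow_eq_level finite_fls_supp_smoothed fin)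

text \<open>The \<open>N\<close>-th differences of level \<open>n\<close> are of size \<open>(2 / 2 ^ N) ^ n * mass n\<close>; the condition says that
  they are \<open>O(2 powr (- \<alpha> * n))\<close>.\<close>

definition decays :: "nat \<Rightarrow> real \<Rightarrow> bool" where
  "decays N \<alpha> \<longleftrightarrow> (\<exists>K. \<forall>n. mass n \<le> K * (2 ^ N / 2 * 2 powr (- \<alpha>)) ^ n)"

text \<open>The condition \<alpha> < 1 is exactly \<open>1 / 2 < 2 powr (- \<alpha>)\<close>, as the
  descent to first differences requires.\<close>

lemma first_difference_decay:
  assumes "finite (fls_supp G)" "0 < \<alpha>" "\<alpha> < 1" "1 \<le> N" "decays N \<alpha>"
  obtains C where
    "\<And>n k. \<bar>level (smoothed N c) G n $$ k - level (smoothed N c) G n $$ (k - 1)\<bar> \<le> C * (2 powr - \<alpha>) ^ n"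
proof -
  obtain K where K: "\<And>n. mass n \<le> K * (2 ^ N / 2 * 2 powr (- \<alpha>)) ^ n"
    using assms(5) unfolding decays_def by blast
  have "1 / 2 < 2 powr (- \<alpha>)"
    using powr_less_mono[of "-1" "-\<alpha>" 2] assms by (simp add: powr_minus)
  from difference_decay[OF assms(1) K this, of 1] assms(4) show ?thesis
    by (auto simp: left_diff_distrib fls_X_times_conv_shift intro: that)
qed

text \<open>Each refined entry is close to its parent at \<open>k div 2\<close>, so consecutive
  interpolants differ by a multiple of \<open>(2 powr - \<alpha>) ^ n\<close>. Summing the geometric
  series gives the limit with a rate; together with the slopes of the interpolants this yields the
  Hoelder bound.\<close>

lemma limit_properties:
  assumes G: "finite (fls_supp G)" and \<alpha>: "0 < \<alpha>" "\<alpha> < 1" and N: "1 \<le> N" and dec: "decays N \<alpha>"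
  shows "convergent (\<lambda>n. approx N G n x)"
    and "\<exists>K. \<forall>n x. \<bar>limit N G x - approx N G n x\<bar> \<le> K * (2 powr - \<alpha>) ^ n"
    and "C_frac \<alpha> (limit N G)"
proof -
  let ?F = "\<lambda>n. level (smoothed N c) G n" and ?\<nu> = "2 powr - \<alpha>"
  have \<nu>: "0 \<le> ?\<nu>" "?\<nu> < 1"
    using powr_less_mono[of "- \<alpha>" 0 2] \<alpha> by auto
  obtain C where C: "\<bar>?F n $$ k - ?F n $$ (k - 1)\<bar> \<le> C * ?\<nu> ^ n" for n k
    using first_difference_decay[OF assms] by blast
  obtain r where r: "finite (fls_supp r)" "smoothed N c = (1 + fls_X) * r" "trig r 0 = 1"
    using smoothed_factor[OF N] by blast
  have r1: "(\<Sum>j\<in>fls_supp r. r $$ j) = 1"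
    using r(3) unfolding trig_0 by (simp only: of_real_eq_1_iff)
  define R where "R = (\<Sum>j\<in>fls_supp r. \<bar>r $$ j\<bar> * \<bar>of_int j\<bar>)"
  have dup: "\<bar>?F (Suc n) $$ k - ?F n $$ (k div 2)\<bar> \<le> R * (C * ?\<nu> ^ n)" for n k
  proof -
    have "\<bar>((1 - fls_X) * ?F n) $$ k\<bar> \<le> C * ?\<nu> ^ n" for k
      using C[of n k] by (simp add: left_diff_distrib fls_X_times_conv_shift)
    from refine_close_to_duplicate[OF r(1) this, of k] show ?thesis
      unfolding r1 R_def level.simps by (simp add: r(2))
  qed
  have step: "\<bar>approx N G (Suc n) x - approx N G n x\<bar> \<le> (C + C * ?\<nu> + R * C) * ?\<nu> ^ n" for n x
    using linear_interp_refine_close[OF C C dup, where x = x]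
    by (simp add: approx_def algebra_simps)
  show "convergent (\<lambda>n. approx N G n x)"
    by (rule geometric_steps_convergent[OF \<nu> step])
  obtain K where K: "\<bar>limit N G x - approx N G n x\<bar> \<le> K * ?\<nu> ^ n" for n x
  proof -
    define K where "K = (C + C * ?\<nu> + R * C) / (1 - ?\<nu>)"
    have "\<bar>limit N G x - approx N G n x\<bar> \<le> K * ?\<nu> ^ n" for n x
      using geometric_steps_convergent(2)[where a = "\<lambda>n. approx N G n x", OF \<nu> step]
      unfolding limit_def limit_fun_def scheme_fun_eq K_def .
    then show ?thesis by (rule that)
  qed
  then show "\<exists>K. \<forall>n x. \<bar>limit N G x - approx N G n x\<bar> \<le> K * ?\<nu> ^ n"
    by blast
  have lip: "\<bar>approx N G n x - approx N G n y\<bar> \<le> C * ?\<nu> ^ n * 2 ^ n * \<bar>x - y\<bar>" for n x y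
  proof (cases "y \<le> x")
    case True
    then show ?thesis
      using linear_interp_lipschitz[of y x n "fls_nth (?F n)" "C * ?\<nu> ^ n"] C[of n "_ + 1"]
      by (simp add: approx_def mult_ac)
  next
    case False
    then show ?thesis
      using linear_interp_lipschitz[of x y n "fls_nth (?F n)" "C * ?\<nu> ^ n"] C[of n "_ + 1"]
      by (simp add: approx_def mult_ac abs_minus_commute)
  qed
  define B where "B = (\<Sum>j\<in>fls_supp G. \<bar>G $$ j\<bar>) + C + K"
  have "\<bar>limit N G x\<bar> \<le> B" for x
    using K[of x 0] linear_interp_close[of "fls_nth G" C 0 x] C[of 0] abs_fls_nth_le_sum[OF G, of "\<lfloor>x\<rfloor>"]
    by (simp add: B_def approx_def)
  from holder_of_approximation[OF \<alpha>(1) K lip this]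
  show "C_frac \<alpha> (limit N G)"
    unfolding C_frac_def .
qed

end

subsection \<open>Derivatives of the limit function\<close>

lemma linear_interp_diff_linear:
  "linear_interp j (\<lambda>k. g k - v * of_int k / 2 ^ j) x = linear_interp j g x - v * x"
proof -
  define u where "u = frac (2 ^ j * x)"
  have "2 ^ j * x = of_int \<lfloor>2 ^ j * x\<rfloor> + u"
    by (simp add: u_def frac_def)
  then have "x = (of_int \<lfloor>2 ^ j * x\<rfloor> + u) / 2 ^ j"
    by (simp add: field_simps)
  then have "v * x = v * ((of_int \<lfloor>2 ^ j * x\<rfloor> + u) / 2 ^ j)"
    by (rule arg_cong)
  also have "\<dots> = v * of_int \<lfloor>2 ^ j * x\<rfloor> / 2 ^ j + u * (v / 2 ^ j)"
    by (simp add: field_simps)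
  finally show ?thesis
    unfolding linear_interp_eq u_def[symmetric]
    by (simp add: right_diff_distrib distrib_left add_divide_distrib)
qed

lemma has_field_derivative_of_holder_remainder:
  fixes f :: "real \<Rightarrow> real"
  assumes "0 < \<alpha>" "\<And>y. \<bar>f y - f x - v * (y - x)\<bar> \<le> K * \<bar>y - x\<bar> powr \<alpha> * \<bar>y - x\<bar>"
  shows "(f has_field_derivative v) (at x)"
proof -
  have "((\<lambda>y. K * \<bar>y - x\<bar> powr \<alpha>) \<longlongrightarrow> K * 0) (at x)"
  proof (intro tendsto_mult_left)
    have "((\<lambda>y. \<bar>y - x\<bar>) \<longlongrightarrow> 0) (at x)"
      by (intro tendsto_eq_intros | simp)+
    then show "((\<lambda>y. \<bar>y - x\<bar> powr \<alpha>) \<longlongrightarrow> 0) (at x)"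
      by (rule tendsto_zero_powrI[OF _ tendsto_const]) (use assms(1) in auto)
  qed
  then have lim: "((\<lambda>y. K * \<bar>y - x\<bar> powr \<alpha>) \<longlongrightarrow> 0) (at x)"
    by simp
  have "((\<lambda>y. (f y - f x) / (y - x) - v) \<longlongrightarrow> 0) (at x)"
  proof (rule Lim_null_comparison[OF _ lim])
    show "\<forall>\<^sub>F y in at x. norm ((f y - f x) / (y - x) - v) \<le> K * \<bar>y - x\<bar> powr \<alpha>"
      unfolding eventually_at_filter
    proof (rule always_eventually, intro allI impI)
      fix y assume "y \<noteq> x"
      then have "(f y - f x) / (y - x) - v = (f y - f x - v * (y - x)) / (y - x)"
        by (simp add: field_simps)
      then show "norm ((f y - f x) / (y - x) - v) \<le> K * \<bar>y - x\<bar> powr \<alpha>"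
        using assms(2)[of y] \<open>y \<noteq> x\<close> by (simp add: abs_divide pos_divide_le_eq)
    qed
  qed
  then show ?thesis
    unfolding has_field_derivative_iff by (rule LIM_zero_cancel)
qed

context trig_symbol
begin

lemma mass_nonneg: "0 \<le> mass n"
  using mass_ge[of n] pi_ge_two by linarith

lemma decays_mono:
  assumes "decays M \<alpha>" "2 ^ M * 2 powr (- \<alpha>) \<le> 2 ^ N * 2 powr (- \<alpha>')"
  shows "decays N \<alpha>'"
proof -
  obtain K where K: "\<And>n. mass n \<le> K * (2 ^ M / 2 * 2 powr (- \<alpha>)) ^ n"
    using assms(1) unfolding decays_def by blast
  have "0 \<le> K"
    using K[of 0] mass_nonneg[of 0] by simp
  have "mass n \<le> K * (2 ^ N / 2 * 2 powr (- \<alpha>')) ^ n" for n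
  proof -
    have "K * (2 ^ M / 2 * 2 powr (- \<alpha>)) ^ n \<le> K * (2 ^ N / 2 * 2 powr (- \<alpha>')) ^ n"
      using \<open>0 \<le> K\<close> assms(2) by (intro mult_left_mono power_mono) auto
    with K[of n] show ?thesis by simp
  qed
  then show ?thesis
    unfolding decays_def by blast
qed

lemma decays_ge: "decays M \<alpha> \<Longrightarrow> M \<le> N \<Longrightarrow> decays N \<alpha>"
  by (erule decays_mono) (simp add: power_increasing)

text \<open>The slopes of the interpolants for \<open>Suc N\<close> are the entries of the scheme
  for \<open>N\<close> applied to the differenced data, hence close to the Hoelder function
  \<open>limit N ((1 - fls_X) * G)\<close>. Subtracting the tangent leaves data of small slope, and
  \<open>n\<close> tending to infinity gives a remainder of order
  \<open>\<bar>y - x\<bar> powr \<alpha> * \<bar>y - x\<bar>\<close>.\<close>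

lemma limit_has_derivative:
  assumes G: "finite (fls_supp G)" and \<alpha>: "0 < \<alpha>" "\<alpha> < 1" and N: "1 \<le> N" and dec: "decays N \<alpha>"
  shows "(limit (Suc N) G has_field_derivative limit N ((1 - fls_X) * G) x) (at x)"
proof -
  let ?H = "(1 - fls_X) * G" and ?\<nu> = "2 powr - \<alpha>"
  let ?f = "limit (Suc N) G" and ?v = "limit N ?H"
  let ?F = "\<lambda>n. level (smoothed (Suc N) c) G n" and ?V = "\<lambda>n. level (smoothed N c) ?H n"
  have H: "finite (fls_supp ?H)"
    by (intro finite_fls_supp_intros G)
  have \<nu>: "0 \<le> ?\<nu>" "?\<nu> < 1"
    using powr_less_mono[of "- \<alpha>" 0 2] \<alpha> by auto
  have dec': "decays (Suc N) \<alpha>"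
    by (rule decays_ge[OF dec]) simp
  obtain K1 where K1: "\<bar>?f x - approx (Suc N) G n x\<bar> \<le> K1 * ?\<nu> ^ n" for n x
    using limit_properties(2)[OF G \<alpha> _ dec'] by auto
  obtain K2 where K2: "\<bar>?v x - approx N ?H n x\<bar> \<le> K2 * ?\<nu> ^ n" for n x
    using limit_properties(2)[OF H \<alpha> N dec] by auto
  obtain K3 where K3: "\<bar>?v x - ?v y\<bar> \<le> K3 * \<bar>x - y\<bar> powr \<alpha>" for x y
    using limit_properties(3)[OF H \<alpha> N dec] unfolding C_frac_def by auto
  have "0 \<le> K3"
    using K3[of 0 1] by simp
  have null: "(\<lambda>n. K * ?\<nu> ^ n) \<longlonglongrightarrow> 0" for K
    using tendsto_mult_right_zero[OF LIMSEQ_realpow_zero[OF \<nu>]] by blast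
  have slope: "?F n $$ (k + 1) - ?F n $$ k = ?V n $$ (k + 1) / 2 ^ n" for n k
  proof -
    have "(1 - fls_X) * ?F n = fls_const ((1 / 2) ^ n) * ?V n"
      using smoothed_difference[of 1 "Suc N" c G n] by simp
    from arg_cong[OF this, of "\<lambda>p. p $$ (k + 1)"] show ?thesis
      by (simp add: left_diff_distrib fls_X_times_conv_shift power_one_over)
  qed
  \<comment> \<open>The slope \<open>w\<close> may be taken at either end point, so that the case
    \<open>y < x\<close> follows by exchanging the two points.\<close>
  have main: "\<bar>approx (Suc N) G n y - approx (Suc N) G n x - w * (y - x)\<bar>
      \<le> (K2 * ?\<nu> ^ n + K3 * (\<bar>y - x\<bar> + (1 / 2) ^ n) powr \<alpha>) * (y - x)"
    if "x \<le> y" and w: "w = ?v x \<or> w = ?v y" for n x y w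
  proof -
    let ?E = "K2 * ?\<nu> ^ n + K3 * (\<bar>y - x\<bar> + (1 / 2) ^ n) powr \<alpha>"
    let ?g = "\<lambda>k. ?F n $$ k - w * of_int k / 2 ^ n"
    have "\<bar>?g (k + 1) - ?g k\<bar> \<le> ?E / 2 ^ n" if k: "\<lfloor>2 ^ n * x\<rfloor> \<le> k" "k \<le> \<lfloor>2 ^ n * y\<rfloor>" for k
    proof -
      \<comment> \<open>The slope on cell \<open>k\<close> is the entry at \<open>k + 1\<close>;
        this grid point may overshoot \<open>y\<close> by one mesh width, which accounts for the
        summand \<open>(1 / 2) ^ n\<close>.\<close>
      define t :: real where "t = of_int (k + 1) / 2 ^ n"
      have "2 ^ n * x \<le> of_int (k + 1)" "of_int (k + 1) \<le> 2 ^ n * y + 1"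
        using k by linarith+
      then have t: "x \<le> t" "t \<le> y + (1 / 2) ^ n"
        unfolding t_def by (simp_all add: field_simps power_one_over)
      have "approx N ?H n t = ?V n $$ (k + 1)"
        unfolding approx_def t_def by (rule linear_interp_grid)
      then have "\<bar>?V n $$ (k + 1) - ?v t\<bar> \<le> K2 * ?\<nu> ^ n"
        using K2[of t n] by (simp add: abs_minus_commute)
      moreover have "\<bar>?v t - w\<bar> \<le> K3 * (\<bar>y - x\<bar> + (1 / 2) ^ n) powr \<alpha>"
      proof -
        obtain z where z: "w = ?v z" "\<bar>t - z\<bar> \<le> \<bar>y - x\<bar> + (1 / 2) ^ n"
        proof (cases "w = ?v x")
          case True
          then show ?thesis using that[of x] t by simp
        next
          case False
          have "0 \<le> (1 / 2 :: real) ^ n" by simp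
          then have "\<bar>t - y\<bar> \<le> \<bar>y - x\<bar> + (1 / 2) ^ n"
            using t \<open>x \<le> y\<close> by linarith
          with False w show ?thesis using that[of y] by blast
        qed
        have "\<bar>?v t - w\<bar> \<le> K3 * \<bar>t - z\<bar> powr \<alpha>"
          unfolding z by (rule K3)
        also have "\<dots> \<le> K3 * (\<bar>y - x\<bar> + (1 / 2) ^ n) powr \<alpha>"
          using z \<alpha> \<open>0 \<le> K3\<close> by (intro mult_left_mono powr_mono2) auto
        finally show ?thesis .
      qed
      ultimately have "\<bar>?V n $$ (k + 1) - w\<bar> \<le> ?E" by linarith
      moreover have "?g (k + 1) - ?g k = (?V n $$ (k + 1) - w) / 2 ^ n"
        using slope[of n k] by (simp add: diff_divide_distrib algebra_simps add_divide_distrib)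
      ultimately show ?thesis
        by (simp add: abs_divide divide_right_mono)
    qed
    then have "\<bar>linear_interp n ?g y - linear_interp n ?g x\<bar> \<le> 2 ^ n * (?E / 2 ^ n) * (y - x)"
      by (intro linear_interp_lipschitz \<open>x \<le> y\<close>)
    moreover have "linear_interp n ?g y - linear_interp n ?g x =
        approx (Suc N) G n y - approx (Suc N) G n x - w * (y - x)"
      by (simp add: approx_def linear_interp_diff_linear algebra_simps)
    ultimately show ?thesis by simp
  qed
  have "\<bar>?f y - ?f x - ?v x * (y - x)\<bar> \<le> K3 * \<bar>y - x\<bar> powr \<alpha> * \<bar>y - x\<bar>" for y
  proof (cases "y = x")
    case False
    have conv: "(\<lambda>n. approx (Suc N) G n z) \<longlonglongrightarrow> ?f z" for z
    proof -
      have "\<forall>\<^sub>F n in sequentially. norm (approx (Suc N) G n z - ?f z) \<le> K1 * ?\<nu> ^ n"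
        using K1 by (simp add: abs_minus_commute)
      then have "(\<lambda>n. approx (Suc N) G n z - ?f z) \<longlonglongrightarrow> 0"
        using null by (rule Lim_null_comparison)
      then show ?thesis by (rule LIM_zero_cancel)
    qed
    have "(\<lambda>n. \<bar>y - x\<bar> + (1 / 2) ^ n) \<longlonglongrightarrow> \<bar>y - x\<bar> + 0"
      by (intro tendsto_add tendsto_const LIMSEQ_realpow_zero) auto
    then have "(\<lambda>n. (K2 * ?\<nu> ^ n + K3 * (\<bar>y - x\<bar> + (1 / 2) ^ n) powr \<alpha>) * \<bar>y - x\<bar>)
        \<longlonglongrightarrow> (0 + K3 * (\<bar>y - x\<bar> + 0) powr \<alpha>) * \<bar>y - x\<bar>"
      using False by (intro tendsto_intros null) auto
    moreover have "(\<lambda>n. \<bar>approx (Suc N) G n y - approx (Suc N) G n x - ?v x * (y - x)\<bar>)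
        \<longlonglongrightarrow> \<bar>?f y - ?f x - ?v x * (y - x)\<bar>"
      by (intro tendsto_intros conv)
    moreover have "\<bar>approx (Suc N) G n y - approx (Suc N) G n x - ?v x * (y - x)\<bar>
      \<le> (K2 * ?\<nu> ^ n + K3 * (\<bar>y - x\<bar> + (1 / 2) ^ n) powr \<alpha>) * \<bar>y - x\<bar>" for n
    proof (cases "x \<le> y")
      case True
      then show ?thesis using main[of x y "?v x" n] by simp
    next
      case False
      then have "\<bar>approx (Suc N) G n x - approx (Suc N) G n y - ?v x * (x - y)\<bar>
        \<le> (K2 * ?\<nu> ^ n + K3 * (\<bar>x - y\<bar> + (1 / 2) ^ n) powr \<alpha>) * (x - y)"
        by (intro main) auto
      moreover have "\<bar>approx (Suc N) G n x - approx (Suc N) G n y - ?v x * (x - y)\<bar> =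
          \<bar>approx (Suc N) G n y - approx (Suc N) G n x - ?v x * (y - x)\<bar>"
        by (simp add: abs_if algebra_simps)
      ultimately show ?thesis
        using False by (simp add: abs_minus_commute)
    qed
    ultimately show ?thesis
      by (auto dest: LIMSEQ_le)
  qed simp
  then show ?thesis
    by (rule has_field_derivative_of_holder_remainder[OF \<alpha>(1)])
qed

lemma deriv_funpow_limit:
  assumes G: "finite (fls_supp G)" and \<alpha>: "0 < \<alpha>" "\<alpha> < 1" and N: "1 \<le> N" and dec: "decays N \<alpha>"
    and "i \<le> q"
  shows "(deriv ^^ i) (limit (N + q) G) = limit (N + q - i) ((1 - fls_X) ^ i * G)"
  using \<open>i \<le> q\<close>
proof (induction i)
  case (Suc i)
  let ?G = "(1 - fls_X) ^ i * G"
  have G': "finite (fls_supp ?G)"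
    by (intro finite_fls_supp_intros G)
  have eq: "N + q - i = Suc (N + q - Suc i)" "N \<le> N + q - Suc i" "1 \<le> N + q - Suc i"
    using Suc.prems N by auto
  have "deriv (limit (N + q - i) ?G) = limit (N + q - Suc i) ((1 - fls_X) * ?G)"
    unfolding eq(1)
    by (rule ext, rule DERIV_imp_deriv,
        rule limit_has_derivative[OF G' \<alpha> eq(3) decays_ge[OF dec eq(2)]])
  then show ?case
    using Suc by (simp add: mult.assoc)
qed simp

lemma continuous_on_C_frac:
  assumes "0 < \<alpha>" "C_frac \<alpha> f"
  shows "continuous_on UNIV f"
  unfolding continuous_on_def
proof
  fix x :: real
  obtain C where C: "\<bar>f x - f y\<bar> \<le> C * \<bar>x - y\<bar> powr \<alpha>" for x y
    using assms(2) unfolding C_frac_def by blast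
  have "((\<lambda>y. \<bar>y - x\<bar>) \<longlongrightarrow> 0) (at x)"
    by (intro tendsto_eq_intros | simp)+
  then have "((\<lambda>y. \<bar>y - x\<bar> powr \<alpha>) \<longlongrightarrow> 0) (at x)"
    by (rule tendsto_zero_powrI[OF _ tendsto_const]) (use assms(1) in auto)
  then have "((\<lambda>y. C * \<bar>y - x\<bar> powr \<alpha>) \<longlongrightarrow> 0) (at x)"
    by (rule tendsto_mult_right_zero)
  then have "((\<lambda>y. f y - f x) \<longlongrightarrow> 0) (at x)"
    by (rule Lim_null_comparison[rotated]) (use C in \<open>auto intro!: always_eventually\<close>)
  then show "(f \<longlongrightarrow> f x) (at x within UNIV)"
    by (simp add: LIM_zero_cancel)
qed

text \<open>The exponent \<alpha> is kept apart from \<open>frac b\<close> because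
  \<open>frac b\<close> may be 0, while convergence and continuity are obtained from a positive
  exponent.\<close>

lemma C_holder_limit:
  assumes G: "finite (fls_supp G)" and b: "0 \<le> b" and N: "1 \<le> N" and
    dec: "decays N \<alpha>" "0 < \<alpha>" "\<alpha> < 1" "frac b \<le> \<alpha>"
  shows "C_holder b (limit (N + nat \<lfloor>b\<rfloor>) G)"
proof -
  define q where "q = nat \<lfloor>b\<rfloor>"
  let ?f = "limit (N + q) G"
  let ?H = "(1 - fls_X) ^ q * G"
  have dq: "(deriv ^^ q) ?f = limit N ?H"
    using deriv_funpow_limit[OF G dec(2,3) N dec(1) order_refl, of q] by simp
  have H: "finite (fls_supp ?H)"
    by (intro finite_fls_supp_intros G)
  have "(deriv ^^ i) ?f differentiable_on UNIV" if "i < q" for i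
  proof -
    have eq: "N + q - i = Suc (N + q - Suc i)" "N \<le> N + q - Suc i" "1 \<le> N + q - Suc i"
      using that N by auto
    have G': "finite (fls_supp ((1 - fls_X) ^ i * G))"
      by (intro finite_fls_supp_intros G)
    show ?thesis
      unfolding deriv_funpow_limit[OF G dec(2,3) N dec(1) less_imp_le[OF that]] eq(1)
      using limit_has_derivative[OF G' dec(2,3) eq(3) decays_ge[OF dec(1) eq(2)]]
      unfolding differentiable_on_def differentiable_def
      by (blast intro: has_derivative_at_withinI dest: has_field_derivative_imp_has_derivative)
  qed
  moreover have "continuous_on UNIV ((deriv ^^ q) ?f)"
    unfolding dq using limit_properties(3)[OF H dec(2,3) N dec(1)] dec(2) by (rule continuous_on_C_frac[rotated])
  moreover have "C_frac (frac b) ((deriv ^^ q) ?f)" if "0 < frac b"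
  proof -
    have "2 powr - \<alpha> \<le> 2 powr - frac b"
      using dec(4) by simp
    then have "decays N (frac b)"
      by (intro decays_mono[OF dec(1)]) simp
    then show ?thesis
      unfolding dq by (rule limit_properties(3)[OF H that frac_lt_1 N])
  qed
  ultimately show ?thesis
    unfolding C_holder_def C_nat_def q_def[symmetric] by blast
qed

end

subsection \<open>Finite differences and the Dirichlet kernel\<close>

text \<open>Backward differences, to match multiplication by \<open>1 - fls_X\<close>.\<close>

definition bdiff :: "real \<Rightarrow> (real \<Rightarrow> real) \<Rightarrow> real \<Rightarrow> real" where
  "bdiff h g x = g x - g (x - h)"

lemma bdiff_funpow_Suc: "(bdiff h ^^ Suc N) g x = (bdiff h ^^ N) g x - (bdiff h ^^ N) g (x - h)"
  unfolding funpow.simps comp_apply by (rule bdiff_def)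

lemma bdiff_funpow_bound:
  assumes "\<And>x. \<bar>g x\<bar> \<le> B"
  shows "\<bar>(bdiff h ^^ N) g x\<bar> \<le> 2 ^ N * B"
proof (induction N arbitrary: x)
  case (Suc N)
  show ?case
    using Suc[of x] Suc[of "x - h"] by (simp add: bdiff_def)
qed (simp add: assms)

lemma bdiff_funpow_diff: "(bdiff h ^^ N) (\<lambda>x. f x - g x) x = (bdiff h ^^ N) f x - (bdiff h ^^ N) g x"
  by (induction N arbitrary: x) (simp_all add: bdiff_def)

lemma bdiff_bound_deriv:
  assumes "0 \<le> h" and d: "\<And>x. (g has_field_derivative g' x) (at x)" and b: "\<And>x. \<bar>g' x\<bar> \<le> B"
  shows "\<bar>bdiff h g x\<bar> \<le> B * h"
proof (cases "h = 0")
  case False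
  then have "x - h < x"
    using assms(1) by simp
  then obtain z where "g x - g (x - h) = (x - (x - h)) * g' z"
    using MVT2[of "x - h" x g g'] d by blast
  then show ?thesis
    using mult_right_mono[OF b[of z] assms(1)] assms(1) by (simp add: bdiff_def abs_mult mult.commute)
qed (simp add: bdiff_def)

lemma has_field_derivative_bdiff:
  assumes "\<And>x. (g has_field_derivative g' x) (at x)"
  shows "(bdiff h g has_field_derivative bdiff h g' x) (at x)"
proof -
  have "((\<lambda>x. g (x - h)) has_field_derivative g' (x - h) * 1) (at x)"
    by (rule DERIV_chain2[OF assms]) (auto intro!: derivative_eq_intros)
  from DERIV_diff[OF assms[of x] this] show ?thesis
    unfolding bdiff_def[abs_def] by simp
qed

text \<open>One mean value estimate per derivative. The derivatives form a family \<open>G\<close>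
  so that the induction can replace every member by its difference.\<close>

lemma bdiff_funpow_bound_deriv:
  assumes "0 \<le> h" and "\<And>i x. i < q \<Longrightarrow> (G i has_field_derivative G (Suc i) x) (at x)"
    and "\<And>x. \<bar>G q x\<bar> \<le> B"
  shows "\<bar>(bdiff h ^^ q) (G 0) x\<bar> \<le> B * h ^ q"
  using assms(2,3)
proof (induction q arbitrary: G B)
  case (Suc q)
  have "\<bar>(bdiff h ^^ q) (bdiff h (G 0)) x\<bar> \<le> (B * h) * h ^ q"
  proof (rule Suc.IH[of "\<lambda>i. bdiff h (G i)"])
    fix i x assume "i < q"
    then have "(G i has_field_derivative G (Suc i) x) (at x)" for x
      using Suc.prems(1) by simp
    then show "(bdiff h (G i) has_field_derivative bdiff h (G (Suc i)) x) (at x)"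
      by (rule has_field_derivative_bdiff)
  next
    show "\<bar>bdiff h (G q) x\<bar> \<le> B * h" for x
      using Suc.prems by (intro bdiff_bound_deriv[OF assms(1)]) auto
  qed
  then show ?case
    by (simp add: funpow_swap1 mult_ac)
qed simp

lemma deriv_funpow_zero_outside:
  assumes "\<And>x. R < \<bar>x\<bar> \<Longrightarrow> f x = (0::real)" "R < \<bar>x\<bar>"
  shows "(deriv ^^ i) f x = 0"
  using assms(2)
proof (induction i arbitrary: x)
  case (Suc i)
  have "open {x::real. R < \<bar>x\<bar>}"
    by (intro open_Collect_less continuous_intros)
  then have "((deriv ^^ i) f has_field_derivative 0) (at x)"
  proof (rule has_field_derivative_transform_within_open[of "\<lambda>_. 0", rotated])
    show "x \<in> {x. R < \<bar>x\<bar>}"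
      using Suc.prems by simp
    show "0 = (deriv ^^ i) f y" if "y \<in> {x. R < \<bar>x\<bar>}" for y
      using Suc.IH[of y] that by simp
  qed simp_all
  then show ?case
    by (simp add: DERIV_imp_deriv)
qed (use assms in auto)

lemma bdiff_funpow_mono:
  assumes "\<And>x. \<bar>(bdiff h ^^ q) f x\<bar> \<le> B" "q \<le> N"
  shows "\<bar>(bdiff h ^^ N) f x\<bar> \<le> 2 ^ (N - q) * B"
proof -
  have "(bdiff h ^^ N) f = (bdiff h ^^ (N - q)) ((bdiff h ^^ q) f)"
    using assms(2) by (metis comp_apply funpow_add le_add_diff_inverse2)
  then show ?thesis
    by (simp add: bdiff_funpow_bound assms(1))
qed

text \<open>Differences of order \<open>N\<close> see smoothness only up to \<open>N\<close>, hence
  the minimum. With \<open>q\<close> derivatives available: if \<open>N \<le> q\<close>, use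
  \<open>N\<close> of them; otherwise use all \<open>q\<close>, and if \<open>frac b > 0\<close> one
  more difference through the Hoelder condition; each remaining difference costs a factor 2. Compact
  support makes the derivatives bounded.\<close>

lemma C_holder_bdiff:
  fixes f :: "real \<Rightarrow> real"
  assumes b: "0 \<le> b" and f: "C_holder b f" and supp: "\<And>x. R < \<bar>x\<bar> \<Longrightarrow> f x = 0"
  shows "\<exists>C. \<forall>x h. 0 < h \<longrightarrow> \<bar>(bdiff h ^^ N) f x\<bar> \<le> C * h powr (min b (real N))"
proof -
  define q where "q = nat \<lfloor>b\<rfloor>"
  let ?G = "\<lambda>i. (deriv ^^ i) f"
  have cont: "continuous_on UNIV (?G q)" and diff: "\<And>i. i < q \<Longrightarrow> ?G i differentiable_on UNIV"
    and frac: "0 < frac b \<Longrightarrow> C_frac (frac b) (?G q)"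
    using f unfolding C_holder_def C_nat_def q_def by auto
  have der: "(?G i has_field_derivative ?G (Suc i) x) (at x)" if "i < q" for i x
    using diff[OF that] by (simp add: differentiable_on_def DERIV_deriv_iff_real_differentiable)
  have bounded: "\<exists>B. \<forall>x. \<bar>?G i x\<bar> \<le> B" if "i \<le> q" for i
  proof -
    have "continuous_on UNIV (?G i)"
      using cont diff[THEN differentiable_imp_continuous_on] that by (cases "i = q") auto
    then have "compact (?G i ` {-R..R})"
      by (intro compact_continuous_image) (auto intro: continuous_on_subset)
    then obtain B where B: "\<And>y. y \<in> ?G i ` {-R..R} \<Longrightarrow> \<bar>y\<bar> \<le> B"
      using compact_imp_bounded bounded_real by metis
    have "\<bar>?G i x\<bar> \<le> max B 0" for x
    proof (cases "R < \<bar>x\<bar>")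
      case True
      then show ?thesis by (simp add: deriv_funpow_zero_outside[OF supp])
    next
      case False
      then have "?G i x \<in> ?G i ` {-R..R}"
        by (intro imageI) (auto simp: abs_le_iff)
      then have "\<bar>?G i x\<bar> \<le> B" by (rule B)
      then show ?thesis by simp
    qed
    then show ?thesis by blast
  qed
  have bq: "b = real q + frac b"
    using b by (simp add: q_def frac_def)
  show ?thesis
  proof (cases "N \<le> q")
    case True
    then obtain B where B: "\<And>x. \<bar>?G N x\<bar> \<le> B"
      using bounded by blast
    have "\<bar>(bdiff h ^^ N) f x\<bar> \<le> B * h powr min b (real N)" if "0 < h" for x h
    proof -
      have "\<bar>(bdiff h ^^ N) (?G 0) x\<bar> \<le> B * h ^ N"
        using that True der B by (intro bdiff_funpow_bound_deriv) auto
      moreover have "min b (real N) = real N"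
        using True bq frac_ge_0[of b] by linarith
      ultimately show ?thesis
        using that by (simp add: powr_realpow)
    qed
    then show ?thesis by blast
  next
    case False
    then have "q < N" by simp
    then have m: "min b (real N) = b"
      using bq frac_lt_1[of b] by linarith
    show ?thesis
    proof (cases "frac b = 0")
      case True
      obtain B where B: "\<And>x. \<bar>?G q x\<bar> \<le> B"
        using bounded by blast
      have "\<bar>(bdiff h ^^ N) f x\<bar> \<le> 2 ^ (N - q) * B * h powr min b (real N)" if "0 < h" for x h
      proof -
        have "\<bar>(bdiff h ^^ q) (?G 0) x\<bar> \<le> B * h ^ q" for x
          using that der B by (intro bdiff_funpow_bound_deriv) auto
        then have "\<bar>(bdiff h ^^ N) (?G 0) x\<bar> \<le> 2 ^ (N - q) * (B * h ^ q)"
          using \<open>q < N\<close> by (intro bdiff_funpow_mono) auto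
        moreover have "h powr min b (real N) = h ^ q"
          using bq True that unfolding m by (metis add.right_neutral powr_realpow)
        ultimately show ?thesis
          by (simp add: mult.assoc)
      qed
      then show ?thesis by blast
    next
      case nz: False
      then have "0 < frac b"
        using frac_ge_0[of b] by linarith
      from frac[OF this] obtain C where C: "\<And>x y. \<bar>?G q x - ?G q y\<bar> \<le> C * \<bar>x - y\<bar> powr frac b"
        unfolding C_frac_def by blast
      have "\<bar>(bdiff h ^^ N) f x\<bar> \<le> 2 ^ (N - Suc q) * C * h powr min b (real N)" if "0 < h" for x h
      proof -
        have "\<bar>(bdiff h ^^ Suc q) f x\<bar> \<le> C * h powr frac b * h ^ q" for x
        proof -
          have "\<bar>(bdiff h ^^ q) (bdiff h (?G 0)) x\<bar> \<le> C * h powr frac b * h ^ q"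
          proof (rule bdiff_funpow_bound_deriv[of h q "\<lambda>i. bdiff h (?G i)"])
            fix i x assume "i < q"
            then show "(bdiff h (?G i) has_field_derivative bdiff h (?G (Suc i)) x) (at x)"
              by (intro has_field_derivative_bdiff der)
          next
            show "\<bar>bdiff h (?G q) x\<bar> \<le> C * h powr frac b" for x
              using C[of x "x - h"] that by (simp add: bdiff_def)
          qed (use that in auto)
          then show ?thesis by (simp add: funpow_swap1)
        qed
        then have "\<bar>(bdiff h ^^ N) f x\<bar> \<le> 2 ^ (N - Suc q) * (C * h powr frac b * h ^ q)"
          using \<open>q < N\<close> by (intro bdiff_funpow_mono) auto
        moreover have "h powr min b (real N) = h powr frac b * h ^ q"
          unfolding m using that by (subst bq) (simp add: powr_add powr_realpow)
        ultimately show ?thesis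
          by (simp add: mult.assoc)
      qed
      then show ?thesis by blast
    qed
  qed
qed

text \<open>A crude form of Jordan's inequality. Up to \<open>pi / 3\<close> the cosine is at least
  \<open>1 / 2\<close>, so \<open>sin x - x / 4\<close> increases; beyond,
  \<open>sin x \<ge> sqrt 3 / 2\<close> exceeds \<open>x / 4 < 1 / 2\<close>.\<close>

lemma sin_ge_quarter:
  assumes "0 \<le> x" "x \<le> pi / 2"
  shows "x / 4 \<le> sin x"
proof (cases "x \<le> pi / 3")
  case True
  have "sin 0 - 0 / 4 \<le> sin x - x / 4"
  proof (rule DERIV_nonneg_imp_nondecreasing[OF assms(1)])
    fix y assume y: "0 \<le> y" "y \<le> x"
    then have "cos (pi / 3) \<le> cos y"
      using True by (intro cos_monotone_0_pi_le) auto
    then show "\<exists>d. ((\<lambda>x. sin x - x / 4) has_real_derivative d) (at y) \<and> 0 \<le> d"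
      by (intro exI[of _ "cos y - 1 / 4"]) (auto intro!: derivative_eq_intros simp: cos_60)
  qed
  then show ?thesis by simp
next
  case False
  then have "sin (pi / 3) \<le> sin x"
    using assms by (intro sin_monotone_2pi_le) auto
  moreover have "1 \<le> sqrt 3" by simp
  ultimately show ?thesis
    using assms pi_half_less_two unfolding sin_60 by linarith
qed

lemma abs_sin_ge_quarter:
  assumes "\<bar>x\<bar> \<le> pi / 2"
  shows "\<bar>x\<bar> / 4 \<le> \<bar>sin x\<bar>"
  using sin_ge_quarter[of x] sin_ge_quarter[of "-x"] assms by (cases "0 \<le> x") auto

text \<open>The sum \<open>1 + z + ... + z^(2^p - 1)\<close> in its product form
  \<open>(1 + z) (1 + z^2) ... (1 + z^(2^(p-1)))\<close>, so that the lemmas on \<open>level\<close>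
  apply.\<close>

definition dirichlet :: "nat \<Rightarrow> real fls" where
  "dirichlet p = level (1 + fls_X) 1 p"

text \<open>The quotient \<open>sin (2 ^ p * t / 2) / sin (t / 2)\<close>, written as a product that
  also makes sense where the denominator vanishes. It carries a sign, which is why even powers are
  taken later.\<close>

definition dirichlet_modulus :: "nat \<Rightarrow> real \<Rightarrow> real" where
  "dirichlet_modulus p t = (\<Prod>i<p. 2 * cos (2 ^ i * t / 2))"

lemma finite_fls_supp_dirichlet: "finite (fls_supp (dirichlet p))"
  unfolding dirichlet_def by (intro finite_fls_supp_level finite_fls_supp_intros)

lemma level_1_left: "level 1 H n = fls_compose_power H (2 ^ n)"
  by (induction n) (simp_all add: fls_compose_power_compose_power mult_ac)

text \<open>The geometric sum: a weighted average turns differences of step 1 into differences of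
  step \<open>2 ^ p\<close>.\<close>

lemma one_minus_X_mult_dirichlet:
  "(1 - fls_X) * dirichlet p = fls_compose_power (1 - fls_X) (2 ^ p)"
  using level_difference[of "1 + fls_X" 1 1 1 p] unfolding level_1_left dirichlet_def by simp

lemma one_plus_cis: "1 + cis t = cis (t / 2) * of_real (2 * cos (t / 2))"
proof -
  have "cis (t / 2) * of_real (2 * cos (t / 2)) = cis (t / 2) * (cis (t / 2) + cis (- (t / 2)))"
    by (simp add: complex_eq_iff)
  also have "\<dots> = cis t + 1"
    by (simp add: distrib_left cis_mult)
  finally show ?thesis by simp
qed

lemma trig_dirichlet: "trig (dirichlet p) t = cis ((2 ^ p - 1) * t / 2) * of_real (dirichlet_modulus p t)"
  unfolding dirichlet_def
proof (induction p arbitrary: t)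
  case (Suc p)
  have "finite (fls_supp (level (1 + fls_X) 1 p))"
    by (intro finite_fls_supp_level finite_fls_supp_intros)
  then have "trig (level (1 + fls_X) 1 (Suc p)) t = (1 + cis t) * trig (level (1 + fls_X) 1 p) (2 * t)"
    by (simp add: trig_mult trig_add finite_fls_supp_intros trig_compose_power)
  also have "\<dots> = (cis (t / 2) * cis ((2 ^ p - 1) * (2 * t) / 2)) *
      of_real (2 * cos (t / 2) * dirichlet_modulus p (2 * t))"
    unfolding Suc one_plus_cis by (simp add: mult_ac)
  also have "cis (t / 2) * cis ((2 ^ p - 1) * (2 * t) / 2) = cis ((2 ^ Suc p - 1) * t / 2)"
    unfolding cis_mult by (rule arg_cong[of _ _ cis]) (simp add: field_simps)
  also have "2 * cos (t / 2) * dirichlet_modulus p (2 * t) = dirichlet_modulus (Suc p) t"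
    unfolding dirichlet_modulus_def
    by (simp add: prod.lessThan_Suc_shift mult_ac del: prod.lessThan_Suc)
  finally show ?case .
qed (simp add: dirichlet_modulus_def)

lemma dirichlet_modulus_mult_sin: "dirichlet_modulus p t * sin (t / 2) = sin (2 ^ p * t / 2)"
proof (induction p)
  case (Suc p)
  have "dirichlet_modulus (Suc p) t * sin (t / 2) = 2 * sin (2 ^ p * t / 2) * cos (2 ^ p * t / 2)"
    using Suc by (simp add: dirichlet_modulus_def mult_ac)
  also have "\<dots> = sin (2 * (2 ^ p * t / 2))"
    by (rule sin_double[symmetric])
  finally show ?case by (simp add: mult.assoc)
qed (simp add: dirichlet_modulus_def)

text \<open>On this neighbourhood of 0 the kernel stays comparable to its peak value
  \<open>2 ^ p\<close>.\<close>

lemma dirichlet_modulus_ge: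
  assumes "\<bar>t\<bar> \<le> pi / 2 ^ p"
  shows "2 ^ p / 4 \<le> \<bar>dirichlet_modulus p t\<bar>"
proof (cases "t = 0")
  case True
  then show ?thesis by (simp add: dirichlet_modulus_def)
next
  case False
  have "\<bar>2 ^ p * t / 2\<bar> \<le> pi / 2"
    using assms by (simp add: abs_mult field_simps)
  then have "\<bar>2 ^ p * t / 2\<bar> / 4 \<le> \<bar>dirichlet_modulus p t\<bar> * \<bar>sin (t / 2)\<bar>"
    using abs_sin_ge_quarter dirichlet_modulus_mult_sin by (metis abs_mult)
  also have "\<dots> \<le> \<bar>dirichlet_modulus p t\<bar> * \<bar>t / 2\<bar>"
    by (intro mult_left_mono abs_sin_x_le_abs_x) simp
  finally have "(2 ^ p / 4) * \<bar>t / 2\<bar> \<le> \<bar>dirichlet_modulus p t\<bar> * \<bar>t / 2\<bar>"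
    by (simp add: abs_mult)
  then show ?thesis
    using False by (simp add: mult_le_cancel_right)
qed

lemma fls_supp_1_plus_X: "fls_supp (1 + fls_X) \<subseteq> {0..1}"
  by (auto simp: fls_supp_def split: if_splits)

lemma fls_supp_level:
  assumes "fls_supp a \<subseteq> {-A..A}" "fls_supp G \<subseteq> {-A..A}"
  shows "fls_supp (level a G n) \<subseteq> {- (A * (2 ^ Suc n - 1))..A * (2 ^ Suc n - 1)}"
proof (induction n)
  case (Suc n)
  have "fls_supp (level a G (Suc n)) \<subseteq> {- A + int 2 * (- (A * (2 ^ Suc n - 1)))..A + int 2 * (A * (2 ^ Suc n - 1))}"
    unfolding level.simps
    by (intro fls_supp_mult_interval assms(1) fls_supp_compose_power_interval[OF Suc]) simp
  then show ?case by (simp add: algebra_simps)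
qed (use assms in simp)

lemma fls_supp_dirichlet: "fls_supp (dirichlet p) \<subseteq> {0..2 ^ p - 1}"
  unfolding dirichlet_def
proof (induction p)
  case 0
  show ?case by (auto simp: fls_supp_def)
next
  case (Suc p)
  have "fls_supp (level (1 + fls_X) 1 (Suc p)) \<subseteq> {0 + int 2 * 0..1 + int 2 * (2 ^ p - 1)}"
    unfolding level.simps
    by (intro fls_supp_mult_interval fls_supp_1_plus_X fls_supp_compose_power_interval[OF Suc]) simp
  then show ?case by (simp add: algebra_simps)
qed

lemma fls_mult_nonneg:
  assumes "finite (fls_supp p)" "\<And>k. 0 \<le> p $$ k" "\<And>k. 0 \<le> q $$ k"
  shows "0 \<le> (p * q) $$ k"
  unfolding fls_times_nth_supp[OF assms(1) subset_refl] using assms by (intro sum_nonneg) auto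

text \<open>The coefficients are nonnegative, so their absolute sum is the value at
  \<open>z = 1\<close>.\<close>

lemma sum_abs_dirichlet_power:
  "(\<Sum>k\<in>fls_supp (dirichlet p ^ N). \<bar>(dirichlet p ^ N) $$ k\<bar>) = 2 ^ (p * N)"
proof -
  have d: "0 \<le> dirichlet p $$ k" for k
    unfolding dirichlet_def
  proof (induction p arbitrary: k)
    case (Suc p)
    show ?case
      unfolding level.simps
      using Suc by (intro fls_mult_nonneg finite_fls_supp_intros) (auto simp: fls_nth_compose_power)
  qed simp
  have "0 \<le> (dirichlet p ^ N) $$ k" for k
  proof (induction N arbitrary: k)
    case (Suc N)
    show ?case
      unfolding power_Suc by (intro fls_mult_nonneg finite_fls_supp_dirichlet d Suc)
  qed simp
  then have "complex_of_real (\<Sum>k\<in>fls_supp (dirichlet p ^ N). \<bar>(dirichlet p ^ N) $$ k\<bar>) = trig (dirichlet p ^ N) 0"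
    by (simp add: trig_0)
  also have "\<dots> = of_real (2 ^ (p * N))"
    unfolding trig_power[OF finite_fls_supp_dirichlet] trig_dirichlet
    by (simp add: dirichlet_modulus_def power_mult)
  finally show ?thesis
    by (simp only: of_real_eq_iff)
qed

lemma compose_power_difference:
  assumes "d > 0" "\<And>k. F $$ k = g (of_int k * u)"
  shows "(fls_compose_power (1 - fls_X) d ^ N * F) $$ k = (bdiff (real d * u) ^^ N) g (of_int k * u)"
proof (induction N arbitrary: k)
  case (Suc N)
  let ?E = "fls_compose_power (1 - fls_X) d ^ N * F"
  have "fls_compose_power (1 - fls_X) d ^ Suc N * F = ?E - fls_X_intpow (int d) * ?E"
    using assms(1) by (simp add: left_diff_distrib mult.assoc)
  then have "(fls_compose_power (1 - fls_X) d ^ Suc N * F) $$ k = ?E $$ k - ?E $$ (k - int d)"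
    by (simp add: fls_X_intpow_times_conv_shift)
  also have "\<dots> = (bdiff (real d * u) ^^ N) g (of_int k * u) - (bdiff (real d * u) ^^ N) g (of_int (k - int d) * u)"
    by (simp only: Suc)
  finally show ?case
    by (simp only: bdiff_funpow_Suc of_int_diff left_diff_distrib of_int_of_nat_eq)
qed (simp add: assms)

lemma one_minus_X_power_nth_0: "((1 - fls_X) ^ N :: real fls) $$ 0 = 1"
proof (induction N)
  case (Suc N)
  have "fls_supp (1 - fls_X) \<subseteq> {0..1}"
    by (auto simp: fls_supp_def split: if_splits)
  from fls_supp_power_interval[OF this, of N] have "((1 - fls_X) ^ N :: real fls) $$ (-1) = 0"
    by (intro fls_nth_notin_supp) auto
  then show ?case
    using Suc by (simp add: left_diff_distrib fls_X_times_conv_shift)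
qed simp

lemma compose_power_difference_nth:
  assumes "d > 0" "\<bar>k\<bar> < int d"
  shows "(fls_compose_power (1 - fls_X) d ^ N :: real fls) $$ k = (if k = 0 then 1 else 0)"
proof -
  have "fls_compose_power (1 - fls_X) d ^ N = fls_compose_power ((1 - fls_X) ^ N :: real fls) d"
    using assms(1) by (simp del: fls_compose_power_diff)
  moreover have "\<not> int d dvd k" if "k \<noteq> 0"
    using assms that zdvd_imp_le[of "int d" "\<bar>k\<bar>"] by auto
  ultimately show ?thesis
    using assms(1) by (auto simp: fls_nth_compose_power one_minus_X_power_nth_0 simp del: fls_compose_power_power)
qed

lemma finite_int_interval:
  assumes "finite (S :: int set)"
  obtains A where "0 \<le> A" "S \<subseteq> {-A..A}"
proof
  let ?A = "\<Sum>k\<in>S. \<bar>k\<bar>"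
  show "0 \<le> ?A" by (simp add: sum_nonneg)
  show "S \<subseteq> {- ?A..?A}"
  proof
    fix k assume "k \<in> S"
    then have "\<bar>k\<bar> \<le> ?A"
      using assms by (intro member_le_sum) auto
    then show "k \<in> {- ?A..?A}" by auto
  qed
qed

context trig_symbol
begin

lemma limit_support:
  assumes G: "finite (fls_supp G)"
  obtains R where "\<And>x. R < \<bar>x\<bar> \<Longrightarrow> limit N G x = 0"
proof -
  let ?a = "smoothed N c"
  have "finite (fls_supp ?a \<union> fls_supp G)"
    using G fin by (simp add: finite_fls_supp_smoothed)
  then obtain A where A: "0 \<le> A" "fls_supp ?a \<union> fls_supp G \<subseteq> {-A..A}"
    by (rule finite_int_interval)
  \<comment> \<open>The \<open>2 * A\<close> comes from the geometric growth of the supports,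
    divided by \<open>2 ^ n\<close>; the added 2 keeps both nodes of the interpolation cell
    outside.\<close>
  have "limit N G x = 0" if x: "of_int (2 * A + 2) < \<bar>x\<bar>" for x
  proof -
    have "approx N G n x = 0" for n
    proof -
      let ?m = "\<lfloor>2 ^ n * x\<rfloor>"
      have z: "level ?a G n $$ k = 0" if "A * 2 ^ Suc n \<le> \<bar>k\<bar>" "k \<noteq> 0" for k
      proof (rule fls_nth_notin_supp)
        have "A * (2 ^ Suc n - 1) < \<bar>k\<bar>"
          using that A(1) by (cases "A = 0") (auto simp: algebra_simps)
        then have "k \<notin> {- (A * (2 ^ Suc n - 1))..A * (2 ^ Suc n - 1)}"
          by (auto simp: abs_if split: if_splits)
        then show "k \<notin> fls_supp (level ?a G n)"
          using fls_supp_level[of ?a A G n] A(2) by blast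
      qed
      have p: "(1::real) \<le> 2 ^ n" by simp
      have "of_int (2 * A + 2) * 2 ^ n < \<bar>2 ^ n * x\<bar>"
        using x by (simp add: abs_mult mult.commute)
      moreover have "of_int (2 * A + 2) * 2 ^ n = of_int (A * 2 ^ Suc n) + 2 * (2::real) ^ n"
        by (simp add: algebra_simps)
      ultimately have "of_int (A * 2 ^ Suc n) + 2 < \<bar>2 ^ n * x\<bar>"
        using p by linarith
      moreover have "0 \<le> A * 2 ^ Suc n"
        using A(1) by simp
      ultimately have "A * 2 ^ Suc n \<le> \<bar>?m\<bar> \<and> ?m \<noteq> 0 \<and> A * 2 ^ Suc n \<le> \<bar>?m + 1\<bar> \<and> ?m + 1 \<noteq> 0"
        by linarith
      then show ?thesis
        by (simp add: approx_def linear_interp_def z del: power_Suc)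
    qed
    then show ?thesis
      by (simp add: limit_def limit_fun_def scheme_fun_eq limI)
  qed
  then show ?thesis by (rule that)
qed

text \<open>The exponent \<kappa> cancels all phases, and \<open>2 * N\<close> being even the
  integrand is nonnegative. Restrict it to \<open>\<bar>t\<bar> \<le> pi / 2 ^ p\<close>, where the
  kernel is near its peak, and drop the first \<open>p\<close> factors of \<beta>; rescaling the
  rest gives \<open>mass n / 2 ^ p\<close>.\<close>

lemma center_coeff_ge:
  fixes N n p :: nat
  defines "\<kappa> \<equiv> int N * (2 ^ p - 1) - s * (2 ^ (n + p) - 1)"
  shows "(2 ^ p / 4) ^ (2 * N) * (mass n / 2 ^ p) \<le> 2 * pi * (dirichlet p ^ (2 * N) * level c 1 (n + p)) $$ \<kappa>"
proof -
  let ?Q = "dirichlet p ^ (2 * N) * level c 1 (n + p)" and ?d = "dirichlet_modulus p"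
  let ?b = "\<lambda>n t. \<Prod>i<n. \<beta> (2 ^ i * t)"
  let ?T = "pi / 2 ^ p"
  have fl: "finite (fls_supp (level c 1 (n + p)))"
    by (intro finite_fls_supp_level fin) simp
  have "((\<lambda>t. trig ?Q t * cis (- of_int \<kappa> * t)) has_integral of_real (2 * pi * ?Q $$ \<kappa>)) {-pi..pi}"
    by (intro fls_nth_integral finite_fls_supp_intros finite_fls_supp_dirichlet fl)
  moreover have "trig ?Q t * cis (- of_int \<kappa> * t) = of_real (?d t ^ (2 * N) * ?b (n + p) t)" for t
  proof -
    have "trig ?Q t * cis (- of_int \<kappa> * t) =
        (cis ((2 ^ p - 1) * t / 2) ^ (2 * N) * cis (- of_int (s * (2 ^ (n + p) - 1)) * t) * cis (- of_int \<kappa> * t))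
        * of_real (?d t ^ (2 * N) * ?b (n + p) t)"
      by (simp add: trig_mult trig_power finite_fls_supp_power finite_fls_supp_dirichlet fl trig_dirichlet
          trig_level power_mult_distrib mult_ac)
    also have "cis ((2 ^ p - 1) * t / 2) ^ (2 * N) * cis (- of_int (s * (2 ^ (n + p) - 1)) * t) * cis (- of_int \<kappa> * t) = cis 0"
      unfolding Complex.DeMoivre cis_mult \<kappa>_def by (rule arg_cong[of _ _ cis]) (simp add: field_simps)
    finally show ?thesis by simp
  qed
  ultimately have "((\<lambda>t. complex_of_real (?d t ^ (2 * N) * ?b (n + p) t)) has_integral of_real (2 * pi * ?Q $$ \<kappa>)) {-pi..pi}"
    by simp
  from has_integral_linear[OF this bounded_linear_Re]
  have whole: "((\<lambda>t. ?d t ^ (2 * N) * ?b (n + p) t) has_integral 2 * pi * ?Q $$ \<kappa>) {-pi..pi}"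
    by (simp add: o_def del: of_real_mult of_real_power of_real_prod)
  have "((\<lambda>t. ?b n (2 ^ p * t)) has_integral mass n / 2 ^ p) {- ?T..?T}"
    using has_integral_affinity'[of "?b n" "mass n" "-pi" pi "2 ^ p" 0] has_integral_mass[of n]
    by (simp add: divide_inverse mult.commute)
  then have part: "((\<lambda>t. (2 ^ p / 4) ^ (2 * N) * ?b n (2 ^ p * t)) has_integral (2 ^ p / 4) ^ (2 * N) * (mass n / 2 ^ p)) {- ?T..?T}"
    by (rule has_integral_mult_right)
  have nn: "0 \<le> ?d t ^ (2 * N) * ?b (n + p) t" for t
    using prod_ge1[of "\<lambda>i. 2 ^ i * t" "n + p"] by (intro mult_nonneg_nonneg) (auto simp: power_mult)
  have le: "(2 ^ p / 4) ^ (2 * N) * ?b n (2 ^ p * t) \<le> ?d t ^ (2 * N) * ?b (n + p) t" if "t \<in> {- ?T..?T}" for t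
  proof (rule mult_mono)
    have "\<bar>t\<bar> \<le> ?T"
      using that by (auto simp: abs_le_iff)
    from power_mono[OF dirichlet_modulus_ge[OF this], of "2 * N"]
    show "(2 ^ p / 4) ^ (2 * N) \<le> ?d t ^ (2 * N)"
      by (simp add: power_even_abs)
    have split: "(\<Prod>i<p + n. f i) = (\<Prod>i<p. f i) * (\<Prod>i<n. f (p + i))" for f :: "nat \<Rightarrow> real"
      by (induction n) (simp_all add: mult.assoc)
    have "1 * ?b n (2 ^ p * t) \<le> ?b p t * ?b n (2 ^ p * t)"
      using prod_ge1[of "\<lambda>i. 2 ^ i * t" p] prod_ge1[of "\<lambda>i. 2 ^ i * (2 ^ p * t)" n]
      by (intro mult_right_mono) auto
    also have "\<dots> = ?b (n + p) t"
      unfolding add.commute[of n p] split by (simp add: power_add mult_ac)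
    finally show "?b n (2 ^ p * t) \<le> ?b (n + p) t" by simp
  qed (use prod_ge1[of "\<lambda>i. 2 ^ i * (2 ^ p * t)" n] in \<open>auto simp: power_mult\<close>)
  have "?T \<le> pi / 1"
    by (intro divide_left_mono) auto
  then have sub: "{- ?T..?T} \<subseteq> {-pi..pi}" by auto
  have int: "(\<lambda>t. ?d t ^ (2 * N) * ?b (n + p) t) integrable_on {- ?T..?T}"
    by (rule integrable_on_subinterval[OF has_integral_integrable[OF whole] sub])
  have "(2 ^ p / 4) ^ (2 * N) * (mass n / 2 ^ p) \<le> integral {- ?T..?T} (\<lambda>t. ?d t ^ (2 * N) * ?b (n + p) t)"
    by (rule has_integral_le[OF part integrable_integral[OF int] le])
  also have "\<dots> \<le> 2 * pi * ?Q $$ \<kappa>"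
    by (rule has_integral_subset_le[OF sub integrable_integral[OF int] whole]) (use nn in auto)
  finally show ?thesis .
qed

end

subsection \<open>Exact regularity\<close>

text \<open>For positive sequences of at most exponential growth this is the limes superior of the
  \<open>n\<close>-th roots; the infimum matches the shape of \<open>decays\<close>.\<close>

definition growth_rate :: "(nat \<Rightarrow> real) \<Rightarrow> real" where
  "growth_rate a = Inf {r. 0 < r \<and> (\<exists>K. \<forall>n. a n \<le> K * r ^ n)}"

lemma growth_rate_le: "0 < r \<Longrightarrow> (\<And>n. a n \<le> K * r ^ n) \<Longrightarrow> growth_rate a \<le> r"
  unfolding growth_rate_def by (rule cInf_lower) (auto intro: bdd_belowI[of _ 0])

lemma le_growth_rate:
  assumes "0 < S" "\<And>n. a n \<le> K * S ^ n"
    and "\<And>r K. 0 < r \<Longrightarrow> (\<And>n. a n \<le> K * r ^ n) \<Longrightarrow> x \<le> r"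
  shows "x \<le> growth_rate a"
  unfolding growth_rate_def using assms by (intro cInf_greatest) auto

lemma growth_rate_less_imp:
  assumes "0 < S" "\<And>n. a n \<le> L * S ^ n" "0 \<le> a 0" "growth_rate a < r"
  shows "\<exists>K. \<forall>n. a n \<le> K * r ^ n"
proof -
  obtain r0 K where r0: "0 < r0" "r0 < r" "\<And>n. a n \<le> K * r0 ^ n"
    using assms(4) cInf_lessD[of "{r. 0 < r \<and> (\<exists>K. \<forall>n. a n \<le> K * r ^ n)}" r] assms(1,2)
    unfolding growth_rate_def by blast
  have "0 \<le> K"
    using r0(3)[of 0] assms(3) by simp
  then have "a n \<le> K * r ^ n" for n
    using r0 by (intro order_trans[OF r0(3)] mult_left_mono power_mono) auto
  then show ?thesis by blast
qed

lemma fls_supp_level_1: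
  assumes "fls_supp a \<subseteq> {-A..A}"
  shows "fls_supp (level a 1 n) \<subseteq> {- (A * (2 ^ n - 1))..A * (2 ^ n - 1)}"
proof (induction n)
  case 0
  show ?case by (auto simp: fls_supp_def)
next
  case (Suc n)
  have "fls_supp (level a 1 (Suc n)) \<subseteq> {- A + int 2 * (- (A * (2 ^ n - 1)))..A + int 2 * (A * (2 ^ n - 1))}"
    unfolding level.simps
    by (intro fls_supp_mult_interval assms fls_supp_compose_power_interval[OF Suc]) simp
  then show ?case by (simp add: algebra_simps)
qed

context trig_symbol
begin

text \<open>The data \<open>dirichlet \<tau> ^ N\<close> have \<open>N\<close>-th difference \<open>(1 - z ^ (2 ^ \<tau>)) ^ N\<close>, which for large \<open>\<tau>\<close> is a
  single unit impulse as far as the central coefficient can see. Averaging with the weights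
  \<open>dirichlet p ^ N\<close> completes the square \<open>dirichlet p ^ (2 * N)\<close>, which is nonnegative on the circle up to
  a monomial.\<close>

lemma mass_le_difference:
  assumes N: "1 \<le> N" and \<alpha>: "0 < \<alpha>" "\<alpha> < 1" and dec: "decays N \<alpha>"
  obtains G where "finite (fls_supp G)"
    "\<And>n B. (\<And>x. \<bar>(bdiff (1 / 2 ^ n) ^^ N) (limit N G) x\<bar> \<le> B) \<Longrightarrow>
      (2 / 2 ^ N) ^ n * mass n / (16 ^ N * (2 * pi)) \<le> B"
proof -
  obtain L where L: "0 \<le> L" "fls_supp c \<subseteq> {-L..L}"
    using finite_int_interval[OF fin] by blast
  \<comment> \<open>Then \<open>2 ^ (\<tau> + j)\<close> exceeds the width of the support of
    \<open>Q\<close> for every \<open>p\<close>, so the shifted copies of \<open>Q\<close> do not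
    meet at \<kappa>.\<close>
  obtain \<tau> :: nat where \<tau>: "2 * L + 2 * int N < 2 ^ \<tau>"
  proof
    show "2 * L + 2 * int N < 2 ^ nat (2 * L + 2 * int N)"
      using L(1) of_nat_less_two_power[of "nat (2 * L + 2 * int N)", where ?'a = int] by simp
  qed
  define G where "G = dirichlet \<tau> ^ N"
  let ?\<nu> = "2 powr - \<alpha>" and ?f = "limit N G" and ?F = "level (smoothed N c) G"
  have G: "finite (fls_supp G)"
    unfolding G_def by (intro finite_fls_supp_power finite_fls_supp_dirichlet)
  have \<nu>: "0 \<le> ?\<nu>" "?\<nu> < 1"
    using powr_less_mono[of "- \<alpha>" 0 2] \<alpha> by auto
  obtain K where K: "\<bar>?f x - approx N G n x\<bar> \<le> K * ?\<nu> ^ n" for n x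
    using limit_properties(2)[OF G \<alpha> N dec] by auto
  have "(2 / 2 ^ N) ^ n * mass n / (16 ^ N * (2 * pi)) \<le> B"
    if B: "\<And>x. \<bar>(bdiff (1 / 2 ^ n) ^^ N) ?f x\<bar> \<le> B" for n B
  proof -
    \<comment> \<open>The left side is free of \<open>p\<close>, while the distance between limit
      and interpolant contributes the last summand, which vanishes as \<open>p\<close>
      grows.\<close>
    have "(2 / 2 ^ N) ^ n * mass n / (16 ^ N * (2 * pi)) \<le> B + 2 ^ N * K * ?\<nu> ^ n * ?\<nu> ^ p" for p
    proof -
      define j where "j = n + p"
      define \<kappa> where "\<kappa> = int N * (2 ^ p - 1) - s * (2 ^ j - 1)"
      define Q where "Q = dirichlet p ^ (2 * N) * level c 1 j"
      define E where "E = fls_compose_power (1 - fls_X) (2 ^ p) ^ N * ?F j"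
      define k0 :: real where "k0 = (1 / 2 ^ N) ^ j * 2 ^ j"
      have center: "(2 ^ p / 4) ^ (2 * N) * (mass n / 2 ^ p) / (2 * pi) \<le> Q $$ \<kappa>"
      proof -
        have "(2 ^ p / 4) ^ (2 * N) * (mass n / 2 ^ p) \<le> Q $$ \<kappa> * (2 * pi)"
          unfolding Q_def \<kappa>_def j_def by (subst mult.commute) (rule center_coeff_ge)
        then show ?thesis
          by (subst pos_divide_le_eq) simp_all
      qed
      have "0 < (2 ^ p / 4) ^ (2 * N) * (mass n / 2 ^ p) / (2 * pi)"
      proof -
        have "0 < mass n"
          using mass_ge[of n] pi_gt_zero by linarith
        then show ?thesis by simp
      qed
      then have Qpos: "0 < Q $$ \<kappa>"
        using center by linarith
      have "fls_supp (dirichlet p ^ (2 * N)) \<subseteq> {0..int (2 * N) * (2 ^ p - 1)}"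
        by (rule fls_supp_power_interval[OF fls_supp_dirichlet])
      moreover have "fls_supp (level c 1 j) \<subseteq> {- (L * 2 ^ j)..L * 2 ^ j}"
        by (rule order_trans[OF fls_supp_level_1[OF L(2)]]) (use L(1) in \<open>auto simp: algebra_simps\<close>)
      ultimately have suppQ: "fls_supp Q \<subseteq> {0 + - (L * 2 ^ j)..int (2 * N) * (2 ^ p - 1) + L * 2 ^ j}"
        unfolding Q_def by (rule fls_supp_mult_interval)
      have width: "int (2 * N) * (2 ^ p - 1) + 2 * L * 2 ^ j < 2 ^ (\<tau> + j)"
      proof -
        have "int (2 * N) * (2 ^ p - 1) \<le> 2 * int N * 2 ^ j"
        proof -
          have "(2::int) ^ p \<le> 2 ^ j"
            by (rule power_increasing) (auto simp: j_def)
          then have "(2::int) ^ p - 1 \<le> 2 ^ j" by linarith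
          then show ?thesis
            unfolding of_nat_mult by (intro mult_mono) auto
        qed
        then have "int (2 * N) * (2 ^ p - 1) + 2 * L * 2 ^ j \<le> (2 * L + 2 * int N) * 2 ^ j"
          by (simp add: algebra_simps)
        also have "\<dots> < 2 ^ \<tau> * 2 ^ j"
          using \<tau> by simp
        finally show ?thesis by (simp add: power_add)
      qed
      have W: "(1 - fls_X) ^ N * G = fls_compose_power (1 - fls_X) (2 ^ \<tau>) ^ N"
        unfolding G_def power_mult_distrib[symmetric] one_minus_X_mult_dirichlet ..
      \<comment> \<open>One power \<open>dirichlet p ^ N\<close> is the averaging weight; the other
        is hidden in the differences of step \<open>2 ^ p\<close>.\<close>
      have "dirichlet p ^ N * E = (dirichlet p ^ N * dirichlet p ^ N) * ((1 - fls_X) ^ N * ?F j)"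
        unfolding E_def one_minus_X_mult_dirichlet[symmetric] power_mult_distrib by (simp only: mult_ac)
      also have "\<dots> = fls_const k0 * (Q * fls_compose_power (fls_compose_power (1 - fls_X) (2 ^ \<tau>) ^ N) (2 ^ j))"
        unfolding top_difference W Q_def k0_def mult_2 power_add by (simp only: mult_ac)
      also have "fls_compose_power (fls_compose_power (1 - fls_X) (2 ^ \<tau>) ^ N) (2 ^ j) =
          fls_compose_power (1 - fls_X :: real fls) (2 ^ (\<tau> + j)) ^ N"
        by (simp add: fls_compose_power_compose_power power_add del: fls_compose_power_diff)
      finally have prod: "dirichlet p ^ N * E = fls_const k0 * (Q * fls_compose_power (1 - fls_X) (2 ^ (\<tau> + j)) ^ N)" .
      have finQ: "finite (fls_supp Q)"
        by (rule finite_subset[OF suppQ]) simp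
      have "(Q * fls_compose_power (1 - fls_X) (2 ^ (\<tau> + j)) ^ N) $$ \<kappa> =
          (\<Sum>i\<in>fls_supp Q. if i = \<kappa> then Q $$ i else 0)"
        unfolding fls_times_nth_supp[OF finQ subset_refl]
      proof (rule sum.cong)
        fix i assume "i \<in> fls_supp Q"
        moreover have "\<kappa> \<in> fls_supp Q"
          using Qpos by (simp add: fls_supp_def)
        ultimately have "{i, \<kappa>} \<subseteq> {0 + - (L * 2 ^ j)..int (2 * N) * (2 ^ p - 1) + L * 2 ^ j}"
          using suppQ by blast
        then have "\<bar>\<kappa> - i\<bar> \<le> int (2 * N) * (2 ^ p - 1) + 2 * (L * 2 ^ j)"
          unfolding insert_subset atLeastAtMost_iff by linarith
        also have "\<dots> < int (2 ^ (\<tau> + j))"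
          using width by (simp add: mult.assoc)
        finally have "\<bar>\<kappa> - i\<bar> < int (2 ^ (\<tau> + j))" .
        then have "(fls_compose_power (1 - fls_X) (2 ^ (\<tau> + j)) ^ N :: real fls) $$ (\<kappa> - i) = (if \<kappa> - i = 0 then 1 else 0)"
          by (intro compose_power_difference_nth) auto
        then show "Q $$ i * (fls_compose_power (1 - fls_X) (2 ^ (\<tau> + j)) ^ N) $$ (\<kappa> - i) = (if i = \<kappa> then Q $$ i else 0)"
          by simp
      qed simp
      also have "\<dots> = Q $$ \<kappa>"
        using finQ fls_nth_notin_supp[of \<kappa> Q] by (simp add: sum.delta)
      finally have at_center: "(dirichlet p ^ N * E) $$ \<kappa> = k0 * Q $$ \<kappa>"
        unfolding prod by simp
      have Ebound: "\<bar>E $$ k\<bar> \<le> B + 2 ^ N * (K * ?\<nu> ^ j)" for k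
      proof -
        let ?g = "approx N G j" and ?x = "of_int k * (1 / 2 ^ j)" and ?h = "1 / 2 ^ n"
        have "?F j $$ k = ?g (of_int k * (1 / 2 ^ j))" for k
          unfolding approx_def using linear_interp_grid[of j "fls_nth (?F j)" k] by simp
        then have "E $$ k = (bdiff (real (2 ^ p) * (1 / 2 ^ j)) ^^ N) ?g ?x"
          unfolding E_def by (intro compose_power_difference) auto
        moreover have "real (2 ^ p) * (1 / 2 ^ j) = ?h"
          by (simp add: j_def power_add)
        ultimately have "E $$ k = (bdiff ?h ^^ N) ?g ?x"
          by simp
        then have "E $$ k = (bdiff ?h ^^ N) ?f ?x - (bdiff ?h ^^ N) (\<lambda>x. ?f x - ?g x) ?x"
          by (simp add: bdiff_funpow_diff)
        moreover have "\<bar>(bdiff ?h ^^ N) (\<lambda>x. ?f x - ?g x) ?x\<bar> \<le> 2 ^ N * (K * ?\<nu> ^ j)"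
          by (rule bdiff_funpow_bound[OF K])
        ultimately show ?thesis
          using B[of ?x] by linarith
      qed
      have "k0 * ((2 ^ p / 4) ^ (2 * N) * (mass n / 2 ^ p) / (2 * pi)) \<le> k0 * Q $$ \<kappa>"
        using center by (intro mult_left_mono) (auto simp: k0_def)
      also have "\<dots> \<le> (B + 2 ^ N * (K * ?\<nu> ^ j)) * 2 ^ (p * N)"
        using abs_fls_times_nth_le[of "dirichlet p ^ N" E \<kappa>, OF finite_fls_supp_power[OF finite_fls_supp_dirichlet] Ebound]
        unfolding at_center sum_abs_dirichlet_power by (simp only: mult.commute abs_le_iff)
      finally have "k0 * ((2 ^ p / 4) ^ (2 * N) * (mass n / 2 ^ p) / (2 * pi)) / 2 ^ (p * N) \<le> B + 2 ^ N * (K * ?\<nu> ^ j)"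
        by (subst pos_divide_le_eq) simp_all
      \<comment> \<open>All powers of \<open>2 ^ p\<close> cancel;
        \<open>16 ^ N = 4 ^ (2 * N)\<close> remains from the lower bound of the kernel.\<close>
      moreover have "k0 * ((2 ^ p / 4) ^ (2 * N) * (mass n / 2 ^ p) / (2 * pi)) / 2 ^ (p * N) =
          (2 / 2 ^ N) ^ n * mass n / (16 ^ N * (2 * pi))"
      proof -
        define u v :: real where "u = 2 ^ p" and "v = 2 ^ (p * N)"
        have nz: "u \<noteq> 0" "v \<noteq> 0"
          by (simp_all add: u_def v_def)
        have "k0 = (2 / 2 ^ N) ^ (n + p)"
          unfolding k0_def j_def power_mult_distrib[symmetric] by simp
        also have "\<dots> = (2 / 2 ^ N) ^ n * (u / v)"
          by (simp add: u_def v_def power_add power_divide mult.commute[of p N] flip: power_mult)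
        finally have k0: "k0 = (2 / 2 ^ N) ^ n * (u / v)" .
        have "(4 ^ (2 * N) :: real) = 16 ^ N"
          by (simp add: power_mult)
        moreover have "(2 ^ p) ^ (2 * N) = v * v"
          unfolding v_def power_mult[symmetric] power_add[symmetric] by (simp add: mult_2 distrib_left)
        ultimately have v: "(u / 4) ^ (2 * N) = v * v / 16 ^ N"
          by (simp add: u_def power_divide)
        have "A * (u / v) * (v * v / 16 ^ N * (m / u) / (2 * pi)) / v = A * m / (16 ^ N * (2 * pi))" for A m
          using nz by simp
        then show ?thesis
          unfolding k0 u_def[symmetric] v_def[symmetric] v .
      qed
      ultimately show ?thesis
        by (simp add: j_def power_add mult.assoc)
    qed
    moreover have "(\<lambda>p. B + 2 ^ N * K * ?\<nu> ^ n * ?\<nu> ^ p) \<longlonglongrightarrow> B + 2 ^ N * K * ?\<nu> ^ n * 0"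
      by (intro tendsto_intros LIMSEQ_realpow_zero \<nu>)
    ultimately show ?thesis
      using LIMSEQ_le_const by force
  qed
  with G show ?thesis by (rule that)
qed

text \<open>The exponent \<alpha> is an a priori one that secures convergence. Smoothness bounds the
  \<open>N\<close>-th differences of step \<open>1 / 2 ^ n\<close> from above, and these dominate
  \<open>mass n\<close> up to scaling.\<close>

lemma decays_of_C_holder:
  assumes N: "1 \<le> N" and \<alpha>: "0 < \<alpha>" "\<alpha> < 1" and dec: "decays N \<alpha>" and b: "0 \<le> b"
    and smooth: "\<And>G. finite (fls_supp G) \<Longrightarrow> C_holder b (limit N G)"
  shows "decays N (min b (real N))"
proof -
  let ?r = "min b (real N)"
  obtain G where G: "finite (fls_supp G)"
    "\<And>n B. (\<And>x. \<bar>(bdiff (1 / 2 ^ n) ^^ N) (limit N G) x\<bar> \<le> B) \<Longrightarrow>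
      (2 / 2 ^ N) ^ n * mass n / (16 ^ N * (2 * pi)) \<le> B"
    using mass_le_difference[OF N \<alpha> dec] by blast
  obtain R where R: "\<And>x. R < \<bar>x\<bar> \<Longrightarrow> limit N G x = 0"
    using limit_support[OF G(1)] by blast
  obtain C where C: "\<And>x h. 0 < h \<Longrightarrow> \<bar>(bdiff h ^^ N) (limit N G) x\<bar> \<le> C * h powr ?r"
    using C_holder_bdiff[where N = N and R = R, OF b smooth[OF G(1)] R] by blast
  have "mass n \<le> (C * (16 ^ N * (2 * pi))) * (2 ^ N / 2 * 2 powr (- ?r)) ^ n" for n
  proof -
    have "(2 / 2 ^ N) ^ n * mass n / (16 ^ N * (2 * pi)) \<le> C * (1 / 2 ^ n) powr ?r"
      by (rule G(2), rule C) simp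
    also have "(1 / 2 ^ n) powr ?r = (2 powr (- ?r)) ^ n"
      by (simp add: powr_minus powr_divide powr_powr mult.commute inverse_eq_divide power_one_over
          flip: powr_realpow)
    finally have "(2 / 2 ^ N) ^ n * mass n \<le> C * (2 powr (- ?r)) ^ n * (16 ^ N * (2 * pi))"
      by (simp add: pos_divide_le_eq)
    then have le: "(2 ^ N / 2) ^ n * ((2 / 2 ^ N) ^ n * mass n) \<le> (2 ^ N / 2) ^ n * (C * (2 powr (- ?r)) ^ n * (16 ^ N * (2 * pi)))"
      by (rule mult_left_mono) simp
    have "mass n = (2 ^ N / 2) ^ n * ((2 / 2 ^ N) ^ n * mass n)"
      unfolding mult.assoc[symmetric] power_mult_distrib[symmetric] by simp
    also note le
    also have "(2 ^ N / 2) ^ n * (C * (2 powr (- ?r)) ^ n * (16 ^ N * (2 * pi))) =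
        (C * (16 ^ N * (2 * pi))) * (2 ^ N / 2 * 2 powr (- ?r)) ^ n"
      unfolding power_mult_distrib by (simp only: mult_ac)
    finally show ?thesis .
  qed
  then show ?thesis
    unfolding decays_def by blast
qed

lemma mass_le_power:
  assumes "\<And>t. \<beta> t \<le> S"
  shows "mass n \<le> 2 * pi * S ^ n"
proof -
  have "((\<lambda>t. S ^ n) has_integral 2 * pi * S ^ n) {-pi..pi}"
    using has_integral_const_real[of "S ^ n" "-pi" pi] by simp
  moreover have "(\<Prod>i<n. \<beta> (2 ^ i * t)) \<le> S ^ n" for t
  proof -
    have "(\<Prod>i<n. \<beta> (2 ^ i * t)) \<le> (\<Prod>i<n. S)"
      using assms ge1 by (intro prod_mono) (auto intro: order_trans[OF zero_le_one])
    then show ?thesis by simp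
  qed
  ultimately show ?thesis
    by (intro has_integral_le[OF has_integral_mass])
qed

lemma growth_rate_mass_bounds:
  assumes "\<And>t. \<beta> t \<le> S"
  shows "1 \<le> growth_rate mass" "growth_rate mass \<le> S"
proof -
  have S: "0 < S"
    using assms[of 0] one by simp
  show "growth_rate mass \<le> S"
    using S mass_le_power[OF assms] by (rule growth_rate_le)
  show "1 \<le> growth_rate mass"
    using S mass_le_power[OF assms]
  proof (rule le_growth_rate)
    fix r K assume r: "0 < r" "\<And>n. mass n \<le> K * r ^ n"
    show "1 \<le> r"
    proof (rule ccontr)
      assume "\<not> 1 \<le> r"
      then have "(\<lambda>n. K * r ^ n) \<longlonglongrightarrow> K * 0"
        using r(1) by (intro tendsto_intros LIMSEQ_realpow_zero) auto
      then have "2 * pi \<le> K * 0"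
        using mass_ge r(2) by (intro LIMSEQ_le_const) (auto intro: order_trans)
      then show False using pi_gt_zero by simp
    qed
  qed
qed

text \<open>Every \<open>x < \<gamma>\<close> satisfies \<open>decays N x\<close>, as
  \<open>growth_rate mass = 2 powr (real N - 1 - \<gamma>)\<close>. The bound
  \<open>S < 2 ^ N / 2\<close> forces \<gamma> > 0, so an exponent \<alpha> in (0, 1) is available
  to start from.\<close>

lemma holder_regularity_smoothed:
  assumes S: "\<And>t. \<beta> t \<le> S" "S < 2 ^ N / 2"
  shows "has_holder_regularity (smoothed N c) (real N - 1 - log 2 (growth_rate mass))"
proof -
  define \<gamma> where "\<gamma> = real N - 1 - log 2 (growth_rate mass)"
  have \<rho>: "1 \<le> growth_rate mass" "growth_rate mass \<le> S"
    using growth_rate_mass_bounds[OF S(1)] by auto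
  have half: "2 ^ N / 2 = 2 powr (real N - 1)"
    by (simp add: powr_diff powr_realpow)
  have rate: "growth_rate mass = 2 powr (real N - 1 - \<gamma>)"
    unfolding \<gamma>_def using \<rho>(1) by simp
  have "growth_rate mass < 2 powr (real N - 1)"
    using \<rho>(2) S(2) half by simp
  then have \<gamma>: "0 < \<gamma>"
    unfolding rate by (simp add: powr_less_cancel_iff)
  have "\<gamma> \<le> real N - 1"
    unfolding \<gamma>_def using \<rho>(1) by simp
  have decays: "decays N x" if "x < \<gamma>" for x
  proof -
    have "growth_rate mass < 2 ^ N / 2 * 2 powr (- x)"
      unfolding half powr_add[symmetric] rate using that by simp
    moreover have "0 < S"
      using \<rho> by linarith
    ultimately show ?thesis
      unfolding decays_def using mass_le_power[OF S(1)] mass_nonneg by (intro growth_rate_less_imp) auto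
  qed
  have N: "1 \<le> N"
    using \<gamma> \<open>\<gamma> \<le> real N - 1\<close> by linarith
  have obtain_data: "\<exists>G. finite (fls_supp G) \<and> fls_nth G = g" if "finite_data g" for g
  proof (intro exI conjI)
    have "finite ((\<lambda>n. - int n) -` {k. g k \<noteq> 0})"
      using that unfolding finite_data_def by (rule finite_vimageI) (auto simp: inj_on_def)
    then have "finite {n. g (- int n) \<noteq> 0}"
      by (simp add: vimage_def)
    then show *: "fls_nth (Abs_fls g) = g"
      by (intro ext nth_Abs_fls) (simp add: eventually_cofinite)
    show "finite (fls_supp (Abs_fls g))"
      using that by (simp add: fls_supp_def * finite_data_def)
  qed
  obtain \<alpha> where \<alpha>: "0 < \<alpha>" "\<alpha> < min 1 \<gamma>"
    using \<gamma> dense[of 0 "min 1 \<gamma>"] by auto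
  have "convergent (\<lambda>j. scheme_fun (smoothed N c) g j x)" if g: "finite_data g" for g x
  proof -
    obtain G where "finite (fls_supp G)" "fls_nth G = g"
      using obtain_data[OF g] by blast
    then show ?thesis
      using limit_properties(1)[of G \<alpha> N x] \<alpha> N decays[of \<alpha>] by (auto simp flip: scheme_fun_eq)
  qed
  moreover have "C_holder b (limit_fun (smoothed N c) g)" if b0: "0 \<le> b" and b1: "b < \<gamma>" and g: "finite_data g" for b g
  proof -
    obtain G where G: "finite (fls_supp G)" "fls_nth G = g"
      using obtain_data[OF g] by blast
    define q where "q = nat \<lfloor>b\<rfloor>"
    have b: "b = real q + frac b"
      using b0 by (simp add: q_def frac_def)
    have "frac b < min 1 (\<gamma> - real q)"
      using b1 b frac_lt_1[of b] by simp
    then obtain a where a: "frac b < a" "a < 1" "a < \<gamma> - real q"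
      using dense[of "frac b" "min 1 (\<gamma> - real q)"] by auto
    have q: "q < N"
      using b b1 frac_ge_0[of b] \<open>\<gamma> \<le> real N - 1\<close> by linarith
    have "decays N (real q + a)"
      using a by (intro decays) simp
    \<comment> \<open>Spending \<open>q\<close> factors \<open>1 + z\<close> on \<open>q\<close>
      derivatives lowers the exponent by \<open>q\<close> and leaves the decay condition
      unchanged.\<close>
    moreover have "2 ^ N * 2 powr (- (real q + a)) = 2 ^ (N - q) * 2 powr (- a)"
      using q by (simp add: powr_add powr_diff powr_realpow power_diff powr_minus field_simps)
    ultimately have "decays (N - q) a"
      by (rule decays_mono[OF _ eq_refl])
    moreover have "1 \<le> N - q"
      using q by simp
    moreover have "0 < a"
      using a(1) frac_ge_0[of b] by linarith
    ultimately have "C_holder b (limit (N - q + nat \<lfloor>b\<rfloor>) G)"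
      using a by (intro C_holder_limit G b0) auto
    then show ?thesis
      using q by (simp add: G limit_def flip: q_def)
  qed
  moreover have "\<exists>g. finite_data g \<and> \<not> C_holder b (limit_fun (smoothed N c) g)" if gb: "\<gamma> < b" for b
  proof (rule ccontr)
    assume "\<not> ?thesis"
    then have "C_holder b (limit N G)" if "finite (fls_supp G)" for G
      using that unfolding limit_def finite_data_def fls_supp_def by blast
    then have "decays N (min b (real N))"
      using \<alpha> N decays[of \<alpha>] \<gamma> gb by (intro decays_of_C_holder) auto
    then obtain K where "\<And>n. mass n \<le> K * (2 ^ N / 2 * 2 powr (- min b (real N))) ^ n"
      unfolding decays_def by blast
    then have "growth_rate mass \<le> 2 ^ N / 2 * 2 powr (- min b (real N))"
      by (intro growth_rate_le) auto
    then have "min b (real N) \<le> \<gamma>"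
      unfolding half powr_add[symmetric] rate by simp
    \<comment> \<open>Both \<gamma> < b and \<open>\<gamma> \<le> real N - 1\<close> hold, so the
      minimum exceeds \<gamma> in either case.\<close>
    then show False
      using gb \<open>\<gamma> \<le> real N - 1\<close> by (simp add: min_def split: if_splits)
  qed
  ultimately show ?thesis
    unfolding has_holder_regularity_def \<gamma>_def[symmetric] using \<gamma> by auto
qed

end

subsection \<open>Pseudo-splines\<close>

lemma gchoose_shift_nonneg: "0 \<le> x \<Longrightarrow> 0 \<le> (x + real k) gchoose k"
  unfolding gchoose_eq_prod by (intro prod_nonneg) auto

lemma gchoose_shift_mono: "0 \<le> x \<Longrightarrow> x \<le> y \<Longrightarrow> (x + real k) gchoose k \<le> (y + real k) gchoose k"
  unfolding gchoose_eq_prod by (intro prod_mono) (auto intro: divide_right_mono)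

lemma binomial_less_two_power:
  assumes "0 < n"
  shows "n choose k < 2 ^ n"
proof (cases "k \<le> n")
  case True
  \<comment> \<open>A second, positive entry of the same row makes the inequality strict.\<close>
  define j where "j = (if k = 0 then n else 0)"
  have "k \<noteq> j" "j \<le> n"
    using assms by (auto simp: j_def)
  then have "(n choose k) + (n choose j) = (\<Sum>i\<in>{k, j}. n choose i)"
    by simp
  also have "\<dots> \<le> (\<Sum>i\<le>n. n choose i)"
    using True \<open>j \<le> n\<close> by (intro sum_mono2) auto
  also have "\<dots> = 2 ^ n"
    by (rule choose_row_sum)
  finally have "(n choose k) + (n choose j) \<le> 2 ^ n" .
  moreover have "0 < n choose j"
    using \<open>j \<le> n\<close> by simp
  ultimately show ?thesis by linarith
qed (simp add: binomial_eq_0)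

definition pseudo_poly :: "real \<Rightarrow> nat \<Rightarrow> real \<Rightarrow> real" where
  "pseudo_poly x l u = (\<Sum>k\<le>l. ((x + real k) gchoose k) * u ^ k)"

definition pseudo_trig :: "real \<Rightarrow> nat \<Rightarrow> real \<Rightarrow> real" where
  "pseudo_trig x l t = pseudo_poly x l ((1 - cos t) / 2)"

definition pseudo_fls :: "real \<Rightarrow> nat \<Rightarrow> real fls" where
  "pseudo_fls x l = (\<Sum>k\<le>l. fls_const ((x + real k) gchoose k) * symb_delta ^ k)"

text \<open>\<open>mass\<close> depends on \<beta> alone and not on the shift \<open>s\<close>, so
  rates of differently centred symbols can be compared.\<close>

abbreviation pseudo_rate :: "real \<Rightarrow> nat \<Rightarrow> real" where
  "pseudo_rate x l \<equiv> growth_rate (trig_symbol.mass (pseudo_trig x l))"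

lemma pseudo_poly_ge1:
  assumes "0 \<le> x" "0 \<le> u"
  shows "1 \<le> pseudo_poly x l u"
proof -
  have "(\<Sum>k\<in>{0}. ((x + real k) gchoose k) * u ^ k) \<le> pseudo_poly x l u"
    unfolding pseudo_poly_def using assms by (intro sum_mono2) (auto simp: gchoose_shift_nonneg)
  then show ?thesis by simp
qed

text \<open>Raise \<open>x\<close> to the integer \<open>n\<close> and \<open>u\<close> to 1; the
  parallel summation formula then evaluates the sum.\<close>

lemma pseudo_poly_le:
  assumes "0 \<le> x" "x \<le> real n" "0 \<le> u" "u \<le> 1"
  shows "pseudo_poly x l u \<le> real ((n + 1 + l) choose l)"
proof -
  have "pseudo_poly x l u \<le> (\<Sum>k\<le>l. ((real n + real k) gchoose k) * 1)"
    unfolding pseudo_poly_def using assms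
    by (intro sum_mono mult_mono gchoose_shift_mono power_le_one) (auto simp: gchoose_shift_nonneg)
  also have "\<dots> = (real n + real l + 1) gchoose l"
    by (simp add: gbinomial_parallel_sum)
  also have "\<dots> = real ((n + 1 + l) choose l)"
    by (simp add: binomial_gbinomial add_ac)
  finally show ?thesis .
qed

lemma trig_symb_delta: "trig symb_delta t = of_real ((1 - cos t) / 2)"
proof -
  have X_inv: "finite (fls_supp fls_X_inv)"
    by (rule finite_subset[of _ "{-1}"]) (auto simp: fls_supp_def split: if_splits)
  have fX: "finite (fls_supp (fls_X_inv + fls_X))"
    by (intro finite_fls_supp_add X_inv finite_fls_supp_X)
  have "symb_delta = fls_const (1/2) + fls_const (- 1/4) * (fls_X_inv + fls_X)"
  proof -
    have "fls_const (- 1/4) = - fls_const (1/4 :: real)"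
      by (rule fls_eqI) simp
    then show ?thesis
      unfolding symb_delta_Laurent by (simp add: distrib_left)
  qed
  then have "trig symb_delta t = trig (fls_const (1/2)) t + trig (fls_const (- 1/4)) t * (trig fls_X_inv t + trig fls_X t)"
    using trig_add[OF finite_fls_supp_const[of "1/2"] finite_fls_supp_mult[OF finite_fls_supp_const[of "- 1/4"] fX], of t]
      trig_mult[OF finite_fls_supp_const[of "- 1/4"] fX, of t] trig_add[OF X_inv finite_fls_supp_X, of t]
    by metis
  then have "trig symb_delta t = of_real (1/2) + of_real (- 1/4) * (cis (- t) + cis t)"
    unfolding trig_const trig_X trig_X_inv .
  also have "cis (- t) + cis t = of_real (2 * cos t)"
    by (simp add: complex_eq_iff)
  finally show ?thesis
    by (simp add: field_simps)
qed

lemma trig_symbol_pseudo: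
  assumes "0 \<le> x"
  shows "trig_symbol (fls_X_intpow (- s) * pseudo_fls x l) (pseudo_trig x l) s"
proof
  have d: "finite (fls_supp symb_delta)"
    unfolding fls_supp_def by (rule finite_support_sigma_delta)
  have t: "trig (pseudo_fls x l) t = of_real (pseudo_trig x l t)" for t
    unfolding pseudo_fls_def pseudo_trig_def pseudo_poly_def
    by (subst trig_sum[THEN conjunct1])
      (auto simp: trig_mult trig_power d finite_fls_supp_intros trig_symb_delta simp del: of_real_divide of_real_diff)
  have p: "finite (fls_supp (pseudo_fls x l))"
    unfolding pseudo_fls_def by (intro trig_sum[THEN conjunct2] finite_fls_supp_intros d) simp
  show "finite (fls_supp (fls_X_intpow (- s) * pseudo_fls x l))"
    by (intro finite_fls_supp_intros p)
  show "trig (fls_X_intpow (- s) * pseudo_fls x l) t = cis (- of_int s * t) * of_real (pseudo_trig x l t)" for t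
    using trig_mult[OF finite_fls_supp_X_intpow p, of "- s" t] trig_X_intpow[of "- s" t] by (simp add: t)
  show "1 \<le> pseudo_trig x l t" for t
    unfolding pseudo_trig_def using assms by (intro pseudo_poly_ge1) auto
  show "pseudo_trig x l 0 = 1"
    by (simp add: pseudo_trig_def pseudo_poly_def power_0_left if_distrib cong: if_cong)
  show "continuous_on UNIV (pseudo_trig x l)"
    unfolding pseudo_trig_def pseudo_poly_def by (intro continuous_intros) auto
qed

text \<open>The condition on \<open>N\<close> gives
  \<open>(n + 1 + l) choose l < 2 ^ (n + 1 + l) \<le> 2 ^ N / 2\<close>. For the primal symbol with
  \<open>n = m - 1\<close> and for the dual one with \<open>n = m\<close> it reads exactly
  \<open>l \<le> m - 1\<close>.\<close>

lemma holder_regularity_pseudo: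
  assumes "0 \<le> x" "x \<le> real n" "n + 2 + l \<le> N"
  shows "holder_regularity (smoothed N (fls_X_intpow (- s) * pseudo_fls x l)) = real N - 1 - log 2 (pseudo_rate x l)"
proof (rule holder_regularity_eq)
  interpret trig_symbol "fls_X_intpow (- s) * pseudo_fls x l" "pseudo_trig x l" s
    by (rule trig_symbol_pseudo[OF assms(1)])
  show "has_holder_regularity (smoothed N (fls_X_intpow (- s) * pseudo_fls x l)) (real N - 1 - log 2 (pseudo_rate x l))"
  proof (rule holder_regularity_smoothed)
    show "pseudo_trig x l t \<le> real ((n + 1 + l) choose l)" for t
      unfolding pseudo_trig_def using assms by (intro pseudo_poly_le) auto
    have "real ((n + 1 + l) choose l) < 2 ^ (n + 1 + l)"
      using binomial_less_two_power[of "n + 1 + l" l] by (metis add_gr_0 of_nat_less_numeral_power_cancel_iff zero_less_one)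
    also have "\<dots> = 2 ^ (n + 2 + l) / (2::real)"
      by simp
    also have "\<dots> \<le> 2 ^ N / 2"
      using assms(3) by (intro divide_right_mono power_increasing) auto
    finally show "real ((n + 1 + l) choose l) < 2 ^ N / 2" .
  qed
qed

lemma pseudo_rate_ge1:
  assumes "0 \<le> x"
  shows "1 \<le> pseudo_rate x l"
proof -
  interpret trig_symbol "fls_X_intpow (- 0) * pseudo_fls x l" "pseudo_trig x l" 0
    by (rule trig_symbol_pseudo[OF assms])
  obtain n where "x \<le> real n"
    using real_arch_simple by blast
  then have "pseudo_trig x l t \<le> real ((n + 1 + l) choose l)" for t
    unfolding pseudo_trig_def using assms by (intro pseudo_poly_le) auto
  then show ?thesis
    by (rule growth_rate_mass_bounds)
qed

text \<open>Coefficientwise bounds carry over to \<beta>, as \<open>(1 - cos t) / 2\<close> is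
  nonnegative. A factor \<open>C\<close> per factor of the product becomes \<open>C ^ n\<close> for
  \<open>mass n\<close>, hence \<open>C\<close> for the rate.\<close>

lemma pseudo_rate_compare:
  fixes x :: real and l :: nat
  assumes x: "0 \<le> x"
  defines "C \<equiv> \<Prod>n<l. (x + 3/2 + real n) / (x + 1 + real n)"
  shows "pseudo_rate x l \<le> pseudo_rate (x + 1/2) l" "pseudo_rate (x + 1/2) l \<le> C * pseudo_rate x l"
proof -
  let ?y = "x + 1/2"
  interpret X: trig_symbol "fls_X_intpow (- 0) * pseudo_fls x l" "pseudo_trig x l" 0
    by (rule trig_symbol_pseudo[OF x])
  interpret Y: trig_symbol "fls_X_intpow (- 0) * pseudo_fls ?y l" "pseudo_trig ?y l" 0
    by (rule trig_symbol_pseudo) (use x in simp)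
  have C: "1 \<le> C"
    unfolding C_def using x by (intro prod_ge_1) (simp add: pos_le_divide_eq)
  \<comment> \<open>The ratio of the coefficients is the product over the first \<open>k\<close>
    factors of \<open>C\<close>, and all factors are at least 1.\<close>
  have upper: "(?y + real k) gchoose k \<le> C * ((x + real k) gchoose k)" if "k \<le> l" for k
  proof -
    have "(?y + real k) gchoose k = (\<Prod>i=1..k. (x + 1/2 + real i) / (x + real i)) * (\<Prod>i=1..k. (x + real i) / real i)"
      unfolding gchoose_eq_prod prod.distrib[symmetric]
    proof (rule prod.cong)
      fix i assume "i \<in> {1..k}"
      then have "x + real i \<noteq> 0" using x by auto
      then show "(?y + real i) / real i = (x + 1/2 + real i) / (x + real i) * ((x + real i) / real i)"
        by simp
    qed simp
    also have "(\<Prod>i=1..k. (x + 1/2 + real i) / (x + real i)) = (\<Prod>n<k. (x + 3/2 + real n) / (x + 1 + real n))"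
      by (rule prod.reindex_bij_witness[of _ Suc "\<lambda>i. i - 1"]) (auto simp: algebra_simps)
    also have "\<dots> \<le> C"
      unfolding C_def using that x by (intro prod_mono2) (auto simp: pos_le_divide_eq)
    finally show ?thesis
      using x by (simp add: gchoose_eq_prod mult_right_mono prod_nonneg)
  qed
  have le: "pseudo_trig x l t \<le> pseudo_trig ?y l t" for t
    unfolding pseudo_trig_def pseudo_poly_def using x by (intro sum_mono mult_right_mono gchoose_shift_mono) auto
  have le_C: "pseudo_trig ?y l t \<le> C * pseudo_trig x l t" for t
    unfolding pseudo_trig_def pseudo_poly_def sum_distrib_left mult.assoc[symmetric]
    by (intro sum_mono mult_right_mono upper) auto
  have pos: "0 \<le> pseudo_trig x l t" "0 \<le> pseudo_trig ?y l t" for t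
    using X.ge1[of t] Y.ge1[of t] by linarith+
  have mass: "X.mass n \<le> Y.mass n" for n
    by (rule has_integral_le[OF X.has_integral_mass Y.has_integral_mass]) (intro prod_mono conjI pos le)
  have mass_C: "Y.mass n \<le> C ^ n * X.mass n" for n
  proof (rule has_integral_le[OF Y.has_integral_mass has_integral_mult_right[OF X.has_integral_mass]])
    fix t
    have "(\<Prod>i<n. pseudo_trig ?y l (2 ^ i * t)) \<le> (\<Prod>i<n. C * pseudo_trig x l (2 ^ i * t))"
      by (intro prod_mono conjI pos le_C)
    then show "(\<Prod>i<n. pseudo_trig ?y l (2 ^ i * t)) \<le> C ^ n * (\<Prod>i<n. pseudo_trig x l (2 ^ i * t))"
      by (simp add: prod.distrib)
  qed
  obtain n where n: "?y \<le> real n"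
    using real_arch_simple by blast
  define S where "S = real ((n + 1 + l) choose l)"
  have S: "0 < S"
    by (simp add: S_def)
  have "pseudo_trig ?y l t \<le> S" for t
    unfolding pseudo_trig_def S_def using x n by (intro pseudo_poly_le) auto
  note bY = Y.mass_le_power[OF this]
  then have bX: "X.mass n \<le> 2 * pi * S ^ n" for n
    using mass order_trans by blast
  show "pseudo_rate x l \<le> pseudo_rate ?y l"
    using S bY
  proof (rule le_growth_rate)
    fix r K assume r: "0 < r" "\<And>n. Y.mass n \<le> K * r ^ n"
    from r(1) order_trans[OF mass r(2)] show "pseudo_rate x l \<le> r"
      by (rule growth_rate_le)
  qed
  have "pseudo_rate ?y l / C \<le> pseudo_rate x l"
    using S bX
  proof (rule le_growth_rate)
    fix r K assume r: "0 < r" "\<And>n. X.mass n \<le> K * r ^ n"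
    have "Y.mass n \<le> K * (C * r) ^ n" for n
    proof -
      have "Y.mass n \<le> C ^ n * (K * r ^ n)"
        using C by (intro order_trans[OF mass_C] mult_left_mono r) auto
      then show ?thesis by (simp add: power_mult_distrib mult_ac)
    qed
    moreover have "0 < C * r"
      using C r(1) by simp
    ultimately have "pseudo_rate ?y l \<le> C * r"
      by (intro growth_rate_le)
    then show "pseudo_rate ?y l / C \<le> r"
      using C by (simp add: pos_divide_le_eq mult.commute)
  qed
  then show "pseudo_rate ?y l \<le> C * pseudo_rate x l"
    using C by (simp add: pos_divide_le_eq mult.commute)
qed

section \<open>Splitting off the power of \<open>1 + z\<close> from the two symbols\<close>

lemma fls_X_inv_eq: "fls_X_inv = fls_X_intpow (- 1)"
  by (simp add: fls_X_inv_conv_shift_1)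

lemma symb_sigma_eq: "symb_sigma = fls_const (1/4) * ((1 + fls_X) ^ 2 * fls_X_intpow (- 1))"
proof -
  have "fls_X_inv * fls_X = (1 :: real fls)"
    unfolding fls_inverse_X[symmetric] by (rule left_inverse) simp
  moreover have "fls_const (1/4) * 2 = (fls_const (1/2) :: real fls)"
    unfolding fls_const_numeral[symmetric] fls_const_mult_const by simp
  ultimately have "fls_const (1/4) * ((1 + fls_X) ^ 2 * fls_X_inv) =
      fls_const (1/4) * fls_X_inv + fls_const (1/2) + fls_const (1/4) * (fls_X :: real fls)"
    by algebra
  then show ?thesis
    unfolding symb_sigma_Laurent fls_X_inv_eq ..
qed

lemma symb_sigma_power:
  "symb_sigma ^ m = fls_const (1 / 4 ^ m) * ((1 + fls_X) ^ (2 * m) * fls_X_intpow (- int m))"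
proof -
  have "fls_X_intpow (- 1) ^ m = (fls_X_intpow (- int m) :: real fls)"
    by (subst fls_X_intpow_power) simp
  moreover have "fls_const (1/4) ^ m = (fls_const (1 / 4 ^ m) :: real fls)"
    by (simp add: power_one_over flip: fls_const_power)
  ultimately show ?thesis
    unfolding symb_sigma_eq power_mult_distrib power_mult by simp
qed

lemma primal_symbol_eq:
  "primal_symbol m l = smoothed (2 * m) (fls_X_intpow (- int m) * pseudo_fls (real m - 1) l)"
proof -
  have "2 * fls_const (1 / 4 ^ m) = (fls_const (2 / 2 ^ (2 * m)) :: real fls)"
    unfolding fls_const_numeral[symmetric] fls_const_mult_const by (simp add: power_mult)
  then show ?thesis
    unfolding primal_symbol_def symb_sigma_power smoothed_def pseudo_fls_def
    by (metis (no_types, lifting) mult.assoc)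
qed

text \<open>The prefactor \<open>(1 + z) / z\<close> adds one smoothing factor and moves the centre
  by one; the constant needs no 2 in front because
  \<open>2 / 2 ^ (2 * m + 1) = 1 / 4 ^ m\<close>.\<close>

lemma dual_symbol_eq:
  "dual_symbol m l = smoothed (2 * m + 1) (fls_X_intpow (- (int m + 1)) * pseudo_fls (real m - 1/2) l)"
proof -
  have c: "fls_const (1 / 4 ^ m) = (fls_const (2 / 2 ^ (2 * m + 1)) :: real fls)"
    by (simp add: power_mult)
  have X: "fls_X_intpow (- (int m + 1)) = fls_X_intpow (- int m) * (fls_X_inv :: real fls)"
    unfolding fls_X_inv_eq fls_X_intpow_times_fls_X_intpow by simp
  have d: "(1 + fls_X) / fls_X = (1 + fls_X) * (fls_X_inv :: real fls)"
    by (simp add: divide_inverse fls_inverse_X)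
  show ?thesis
    unfolding dual_symbol_def symb_sigma_power smoothed_def pseudo_fls_def[symmetric] c X d power_add power_one_right
    by (simp only: mult_ac)
qed

unbundle no fps_syntax

theorem theorem5:
  fixes m l :: nat
  assumes "1 \<le> m" and "l \<le> m - 1"
  shows
    "holder_regularity (primal_symbol m l)
       + log 2 (2 * (\<Prod>n<l. (real m + real n) / (real m + 1/2 + real n)))
     \<le> holder_regularity (dual_symbol m l)
   \<and> holder_regularity (dual_symbol m l) \<le> holder_regularity (primal_symbol m l) + 1
   \<and> holder_regularity (dual_symbol m l)
       + log 2 (2 * (\<Prod>n<l. (real m + 1/2 + real n) / (real m + 1 + real n)))
     \<le> holder_regularity (primal_symbol (m + 1) l)
   \<and> holder_regularity (primal_symbol (m + 1) l) \<le> holder_regularity (dual_symbol m l) + 1"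
proof -
  let ?R = "\<lambda>x. pseudo_rate x l"
  have primal: "holder_regularity (primal_symbol m l) = real (2 * m) - 1 - log 2 (?R (real m - 1))"
    unfolding primal_symbol_eq using assms by (intro holder_regularity_pseudo[of _ "m - 1"]) auto
  have dual: "holder_regularity (dual_symbol m l) = real (2 * m + 1) - 1 - log 2 (?R (real m - 1/2))"
    unfolding dual_symbol_eq using assms by (intro holder_regularity_pseudo[of _ m]) auto
  have primal': "holder_regularity (primal_symbol (m + 1) l) = real (2 * (m + 1)) - 1 - log 2 (?R (real m))"
    unfolding primal_symbol_eq using assms
    by (subst holder_regularity_pseudo[of _ m]) auto
  \<comment> \<open>Taken at \<open>x = m - 1\<close> this compares primal with dual, at
    \<open>x = m - 1/2\<close> dual with the next primal symbol.\<close>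
  have step: "log 2 (?R x) \<le> log 2 (?R (x + 1/2))"
    "log 2 (?R (x + 1/2)) + log 2 (2 * (\<Prod>n<l. (x + 1 + real n) / (x + 3/2 + real n))) \<le> 1 + log 2 (?R x)"
    if "0 \<le> x" for x
  proof -
    let ?P = "\<Prod>n<l. (x + 1 + real n) / (x + 3/2 + real n)" and ?C = "\<Prod>n<l. (x + 3/2 + real n) / (x + 1 + real n)"
    have pos: "0 < ?R x" "0 < ?R (x + 1/2)"
      using pseudo_rate_ge1[of x l] pseudo_rate_ge1[of "x + 1/2" l] that by linarith+
    show "log 2 (?R x) \<le> log 2 (?R (x + 1/2))"
      using pseudo_rate_compare(1)[OF that, of l] pos by simp
    have P: "0 < ?P" "?C * ?P = 1"
      using that by (auto intro!: prod_pos prod.neutral simp flip: prod.distrib)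
    have "?R (x + 1/2) * (2 * ?P) \<le> ?C * ?R x * (2 * ?P)"
      using P(1) by (intro mult_right_mono pseudo_rate_compare(2) that) auto
    also have "\<dots> = 2 * ?R x"
      using P(2) by (simp add: mult_ac)
    finally have "log 2 (?R (x + 1/2) * (2 * ?P)) \<le> log 2 (2 * ?R x)"
      using pos P(1) by (subst log_le_cancel_iff) auto
    moreover have "log 2 (?R (x + 1/2) * (2 * ?P)) = log 2 (?R (x + 1/2)) + log 2 (2 * ?P)"
      by (rule log_mult_pos) (use pos P(1) in linarith)+
    moreover have "log 2 (2 * ?R x) = 1 + log 2 (?R x)"
      using log_mult_pos[of 2 "?R x" 2] pos by simp
    ultimately show "log 2 (?R (x + 1/2)) + log 2 (2 * ?P) \<le> 1 + log 2 (?R x)"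
      by linarith
  qed
  show ?thesis
    unfolding primal dual primal'
    using step[of "real m - 1"] step[of "real m - 1/2"] assms by (simp add: algebra_simps)
qed

end
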